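(* Let $n\ge3$, let $K$ be a finite oriented $(n-1)$-dimensional strongly connected pseudo-manifold, and let $P\colon|K|\to\mathbb{R}^n$ be a flexible polyhedron of combinatorial type $K$. Then for every flex $P_t$, $t\in[0,1]$, of $P$, the generalized oriented volume $V(P_t)$ is constant in $t$.
   Context: An abstract simplicial complex $K$ is a $k$-dimensional pseudo-manifold if every simplex of $K$ is contained in a $k$-simplex and every $(k-1)$-simplex is contained in exactly two $k$-simplices. It is strongly connected if any two $k$-simplices can be joined by a sequence of $k$-simplices in which consecutive ones share a common $(k-1)$-face. It is oriented if its $k$-simplices are endowed with consistent orientations. $|K|$ is the geometric realization. A simplicial polyhedron of combinatorial type $K$ (where $\dim K=n-1$) is a map $P\colon|K|\to\mathbb{R}^n$ whose restriction to every simplex is linear (affine); it need not be injective and may be degenerate. A flex of $P\colon|K|\to\mathbb{R}^n$ is a continuous family of polyhedra $P_t\colon|K|\to\mathbb{R}^n$, $t\in[0,1]$, of the same combinatorial type such that $P_0=P$, the edge lengths of $P_t$ (the lengths $\|P_t(u)-P_t(v)\|$ for edges $\{u,v\}$ of $K$) are constant in $t$, and $P_0$ cannot be taken to $P_1$ by an isometry of $\mathbb{R}^n$. A polyhedron is flexible if it admits a flex. The generalized oriented volume is $V(P)=\sum_{i=1}^q V(O,P(v_1^{(i)}),\ldots,P(v_n^{(i)}))$, where $\{v_1^{(i)},\ldots,v_n^{(i)}\}$ are all distinct positively oriented $(n-1)$-simplices of $K$, $O\in\mathbb{R}^n$ is an arbitrary point (the result does not depend on it), and $V(p_0,\ldots,p_n)=\frac1{n!}\det(p_1-p_0,\ldots,p_n-p_0)$.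 *)

theory Defs
  imports "HOL-Analysis.Analysis" "HOL-Combinatorics.Permutations"
begin

subsection \<open>Abstract simplicial complexes and oriented pseudo-manifolds\<close>

text \<open>Simplices are nonempty; the vertices of \<open>K\<close> are the elements of \<open>\<Union>K\<close>.\<close>

definition simplicial_complex :: "'v set set \<Rightarrow> bool" where
  "simplicial_complex K \<longleftrightarrow>
     (\<forall>\<sigma>\<in>K. finite \<sigma> \<and> \<sigma> \<noteq> {}) \<and>
     (\<forall>\<sigma>\<in>K. \<forall>\<tau>. \<tau> \<noteq> {} \<and> \<tau> \<subseteq> \<sigma> \<longrightarrow> \<tau> \<in> K)"

definition simplices :: "'v set set \<Rightarrow> nat \<Rightarrow> 'v set set" where
  "simplices K k = {\<sigma> \<in> K. card \<sigma> = Suc k}"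

text \<open>The next definitions are meant for dimension \<open>k \<ge> 1\<close>, because of the truncated
  subtraction in \<open>k - 1\<close>.\<close>

definition pseudo_manifold :: "'v set set \<Rightarrow> nat \<Rightarrow> bool" where
  "pseudo_manifold K k \<longleftrightarrow>
     simplicial_complex K \<and>
     (\<forall>\<rho>\<in>K. \<exists>\<sigma>\<in>simplices K k. \<rho> \<subseteq> \<sigma>) \<and>
     (\<forall>\<rho>\<in>simplices K (k - 1). card {\<sigma> \<in> simplices K k. \<rho> \<subseteq> \<sigma>} = 2)"

definition adjacent_simplices :: "'v set set \<Rightarrow> nat \<Rightarrow> 'v set \<Rightarrow> 'v set \<Rightarrow> bool" where
  "adjacent_simplices K k \<sigma> \<tau> \<longleftrightarrow>
     \<sigma> \<in> simplices K k \<and> \<tau> \<in> simplices K k \<and>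
     (\<exists>\<rho>\<in>simplices K (k - 1). \<rho> \<subseteq> \<sigma> \<and> \<rho> \<subseteq> \<tau>)"

definition strongly_connected :: "'v set set \<Rightarrow> nat \<Rightarrow> bool" where
  "strongly_connected K k \<longleftrightarrow>
     (\<forall>\<sigma>\<in>simplices K k. \<forall>\<tau>\<in>simplices K k. (adjacent_simplices K k)\<^sup>*\<^sup>* \<sigma> \<tau>)"

definition orderings :: "'v set \<Rightarrow> 'v list set" where
  "orderings \<sigma> = {xs. distinct xs \<and> set xs = \<sigma>}"

text \<open>A choice of orientations of all \<open>k\<close>-simplices is encoded by the set \<open>\<Omega>\<close> of their positive
  orderings: among the orderings of each \<open>k\<close>-simplex, \<open>\<Omega>\<close> singles out exactly one of the two
  classes modulo even permutations.\<close>

definition simplex_orientations :: "'v set set \<Rightarrow> nat \<Rightarrow> 'v list set \<Rightarrow> bool" where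
  "simplex_orientations K k \<Omega> \<longleftrightarrow>
     \<Omega> \<subseteq> (\<Union>\<sigma>\<in>simplices K k. orderings \<sigma>) \<and>
     (\<forall>\<sigma>\<in>simplices K k. \<forall>xs\<in>orderings \<sigma>. \<forall>p. p permutes {..<length xs} \<longrightarrow>
        (permute_list p xs \<in> \<Omega> \<longleftrightarrow> (if evenperm p then xs \<in> \<Omega> else xs \<notin> \<Omega>)))"

text \<open>The orientation of \<open>\<sigma> = {a} \<union> \<rho>\<close> induces on its facet \<open>\<rho>\<close> the orientation for which \<open>ys\<close> is
  positive iff \<open>a # ys\<close> is positive for \<open>\<sigma>\<close>.  Orientations are consistent if any two distinct
  \<open>k\<close>-simplices with a common facet induce opposite orientations on it.\<close>

definition consistent_orientation :: "'v set set \<Rightarrow> nat \<Rightarrow> 'v list set \<Rightarrow> bool" where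
  "consistent_orientation K k \<Omega> \<longleftrightarrow>
     simplex_orientations K k \<Omega> \<and>
     (\<forall>\<rho>\<in>simplices K (k - 1). \<forall>ys\<in>orderings \<rho>. \<forall>a b.
        a \<noteq> b \<and> a \<notin> \<rho> \<and> b \<notin> \<rho> \<and> insert a \<rho> \<in> simplices K k \<and> insert b \<rho> \<in> simplices K k \<longrightarrow>
        (a # ys \<in> \<Omega> \<longleftrightarrow> b # ys \<notin> \<Omega>))"

subsection \<open>Simplicial polyhedra and flexes\<close>

text \<open>Points of the geometric realization are given by their barycentric coordinates.  For finite
  \<open>K\<close> its topology is the one induced by the product topology on \<open>'v \<Rightarrow> real\<close>.\<close>

definition closed_simplex :: "'v set \<Rightarrow> ('v \<Rightarrow> real) set" where
  "closed_simplex \<sigma> = {x. (\<forall>v. 0 \<le> x v) \<and> (\<forall>v. v \<notin> \<sigma> \<longrightarrow> x v = 0) \<and> (\<Sum>v\<in>\<sigma>. x v) = 1}"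

definition realization :: "'v set set \<Rightarrow> ('v \<Rightarrow> real) set" where
  "realization K = (\<Union>\<sigma>\<in>K. closed_simplex \<sigma>)"

definition vertex_point :: "'v \<Rightarrow> ('v \<Rightarrow> real)" where
  "vertex_point v = indicator {v}"

definition polyhedron_of_type :: "'v set set \<Rightarrow> (('v \<Rightarrow> real) \<Rightarrow> real ^ 'n) \<Rightarrow> bool" where
  "polyhedron_of_type K P \<longleftrightarrow>
     (\<forall>\<sigma>\<in>K. \<forall>x\<in>closed_simplex \<sigma>. P x = (\<Sum>v\<in>\<sigma>. x v *\<^sub>R P (vertex_point v)))"

definition isometry_of_space :: "(real ^ 'n \<Rightarrow> real ^ 'n) \<Rightarrow> bool" where
  "isometry_of_space f \<longleftrightarrow> (\<forall>x y. dist (f x) (f y) = dist x y)"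

definition is_flex ::
    "'v set set \<Rightarrow> (('v \<Rightarrow> real) \<Rightarrow> real ^ 'n) \<Rightarrow> (real \<Rightarrow> ('v \<Rightarrow> real) \<Rightarrow> real ^ 'n) \<Rightarrow> bool" where
  "is_flex K P Pt \<longleftrightarrow>
     (\<forall>t\<in>{0..1}. polyhedron_of_type K (Pt t)) \<and>
     continuous_on ({0..1} \<times> realization K) (\<lambda>(t, x). Pt t x) \<and>
     (\<forall>x\<in>realization K. Pt 0 x = P x) \<and>
     (\<forall>u v. {u, v} \<in> simplices K 1 \<longrightarrow>
        (\<lambda>t. dist (Pt t (vertex_point u)) (Pt t (vertex_point v))) constant_on {0..1}) \<and>
     (\<nexists>f. isometry_of_space f \<and> (\<forall>x\<in>realization K. Pt 1 x = f (Pt 0 x)))"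

definition flexible :: "'v set set \<Rightarrow> (('v \<Rightarrow> real) \<Rightarrow> real ^ 'n) \<Rightarrow> bool" where
  "flexible K P \<longleftrightarrow> (\<exists>Pt. is_flex K P Pt)"

subsection \<open>Generalized oriented volume\<close>

text \<open>A determinant of a list of \<open>n\<close> vectors in \<open>real ^ 'n\<close> requires an ordering of the coordinates.
  It is given by a numbering \<open>e\<close>, a bijection from \<open>'n\<close> onto \<open>{..<CARD('n)}\<close>, which identifies
  \<open>real ^ 'n\<close> with the standard oriented n-space.  Below, the column with number \<open>k\<close> is
  \<open>ps ! k - p0\<close>.\<close>

definition oriented_volume :: "('n \<Rightarrow> nat) \<Rightarrow> real ^ 'n \<Rightarrow> (real ^ 'n) list \<Rightarrow> real" where
  "oriented_volume e p0 ps = det (\<chi> i j. (ps ! e j - p0) $ i) / fact CARD('n)"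

text \<open>The summand does not depend on which positive ordering of \<open>\<sigma>\<close> is selected, as any two of
  them differ by an even permutation.\<close>

definition generalized_volume ::
    "('n \<Rightarrow> nat) \<Rightarrow> 'v set set \<Rightarrow> 'v list set \<Rightarrow> real ^ 'n \<Rightarrow> (('v \<Rightarrow> real) \<Rightarrow> real ^ 'n) \<Rightarrow> real" where
  "generalized_volume e K \<Omega> O0 P =
     (\<Sum>\<sigma>\<in>simplices K (CARD('n) - 1).
        oriented_volume e O0
          (map (\<lambda>v. P (vertex_point v)) (SOME xs. xs \<in> orderings \<sigma> \<and> xs \<in> \<Omega>)))"

end

theory Submission
  imports Defs "HOL-Combinatorics.Multiset_Permutations"
begin

text \<open>
  The proof is based on Sabitov's idea that the volume is integral over the ring generated by the
  squared edge lengths. By the valuative criterion of integrality it has to be shown that, in a field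
  with a valuation ring \<open>A\<close>, a polyhedron with all squared edge lengths in \<open>A\<close> has its volume in \<open>A\<close> (up to
  an integer factor); this is \<open>pseudo_manifold_volume_integral\<close>. For a flex the squared edge lengths are
  constant. If the volume took infinitely many values, a sequence of distinct ones would define a
  transcendental element of an ultrapower of the complex numbers, and some valuation ring contains all
  constants but not this element (\<open>valuation_ring_excluding_injective_sequence\<close>). Therefore the
  volume takes only finitely many values along a flex, and being continuous it is constant. Complex
  numbers are used, although all polyhedra are real, because isotropic vectors are needed.

  To see that the volume lies in \<open>A\<close>, join two vertices of the polyhedron if their squared distance is in
  \<open>A\<close> and consider the clique complex of this graph. It contains the fundamental cycle of the
  pseudo-manifold, which has dimension \<open>n - 1\<close>. If this cycle is the boundary of an
  \<open>n\<close>-dimensional chain of the clique complex, then the volume is the sum of the volumes of the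
  \<open>n\<close>-simplices of the chain, and the square of each of these is a Gram determinant in \<open>A\<close>
  (\<open>boundary_volume_integral\<close>). So it suffices that the homology of the clique complex vanishes in dimension
  \<open>n - 1\<close>.

  Vertices are removed one by one. Seen from a vertex \<open>q\<close>, the link consists of vectors of integral norm,
  joined if their inner product is integral. For such vectors in dimension \<open>d\<close> the
  homology vanishes in dimensions \<open>\<ge> \<lfloor>d / 2\<rfloor>\<close> (\<open>cycles_bound_integral_products\<close>), because the link of a suitably
  chosen vector is a complex of the same kind in the orthogonal complement of a hyperbolic plane. Hence
  the homology of the clique complex of points in dimension \<open>n\<close> vanishes in dimensions
  \<open>\<ge> \<lfloor>n / 2\<rfloor> + 1\<close>, which includes \<open>n - 1\<close> if \<open>n \<ge> 3\<close>.
\<close>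

section \<open>Alternating chains\<close>

text \<open>A simplicial chain with oriented simplices is encoded by its coefficient function on vertex lists:
  the coefficient of an oriented simplex changes sign under a swap of neighbouring vertices, hence
  integral chains vanish on degenerate lists. With this encoding the boundary is a sum over the possible first
  vertices and needs no signs.\<close>
definition alternating :: "('v list \<Rightarrow> 'a::comm_ring_1) \<Rightarrow> bool" where
  "alternating c \<longleftrightarrow> (\<forall>us a b vs. c (us @ a # b # vs) = - c (us @ b # a # vs))"

definition boundary :: "'v set \<Rightarrow> ('v list \<Rightarrow> int) \<Rightarrow> 'v list \<Rightarrow> int" where
  "boundary S c ys = (\<Sum>v\<in>S. c (v # ys))"

text \<open>The join of the vertex \<open>q\<close> with the chain \<open>g\<close>: the signed sum of the values of \<open>g\<close> over all ways to
  delete an occurrence of \<open>q\<close>.\<close>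
fun vertex_cone :: "'v \<Rightarrow> ('v list \<Rightarrow> int) \<Rightarrow> 'v list \<Rightarrow> int" where
  "vertex_cone q g [] = 0"
| "vertex_cone q g (x # xs) = (if x = q then g xs else 0) - vertex_cone q (\<lambda>ys. g (x # ys)) xs"

lemma alternating_swap: "alternating c \<Longrightarrow> c (us @ a # b # vs) = - c (us @ b # a # vs)"
  unfolding alternating_def by blast

lemma alternating_swap_front: "alternating c \<Longrightarrow> c (a # b # vs) = - c (b # a # vs)"
  using alternating_swap[of c "[]" a b vs] by simp

lemma alternating_Cons: "alternating c \<Longrightarrow> alternating (\<lambda>ys. c (x # ys))"
  unfolding alternating_def by (metis append_Cons)

lemma alternating_add:
  assumes "alternating c" "alternating d"
  shows "alternating (\<lambda>xs. c xs + d xs)"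
  unfolding alternating_def
proof (intro allI)
  fix us a b vs
  show "c (us @ a # b # vs) + d (us @ a # b # vs) = - (c (us @ b # a # vs) + d (us @ b # a # vs))"
    using alternating_swap[OF assms(1), of us a b vs] alternating_swap[OF assms(2), of us a b vs]
    by (metis minus_add_distrib)
qed

lemma alternating_diff:
  assumes "alternating c" "alternating d"
  shows "alternating (\<lambda>xs. c xs - d xs)"
  unfolding alternating_def
proof (intro allI)
  fix us a b vs
  show "c (us @ a # b # vs) - d (us @ a # b # vs) = - (c (us @ b # a # vs) - d (us @ b # a # vs))"
    using alternating_swap[OF assms(1), of us a b vs] alternating_swap[OF assms(2), of us a b vs]
    by (metis minus_diff_minus)
qed

lemma alternating_boundary:
  assumes "alternating c"
  shows "alternating (boundary S c)"
proof -
  have "c (v # us @ a # b # vs) = - c (v # us @ b # a # vs)" for v us a b vs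
    using alternating_swap[OF assms, of "v # us" a b vs] by simp
  then have "(\<Sum>v\<in>S. c (v # us @ a # b # vs)) = (\<Sum>v\<in>S. - c (v # us @ b # a # vs))" for us a b vs
    by (rule sum.cong[OF refl])
  then show ?thesis
    unfolding alternating_def boundary_def sum_negf by blast
qed

lemma alternating_move_to_front:
  assumes "alternating c"
  shows "c (us @ q # vs) = (- 1) ^ length us * c (q # us @ vs)"
proof (induction us arbitrary: vs rule: rev_induct)
  case (snoc u us)
  have "c ((us @ [u]) @ q # vs) = - c (us @ q # u # vs)"
    using alternating_swap[OF assms, of us u q vs] by simp
  then show ?case
    using snoc.IH[of "u # vs"] by simp
qed simp

lemma alternating_eq_0_if_not_distinct:
  fixes c :: "'v list \<Rightarrow> int"
  assumes "alternating c" "\<not> distinct xs"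
  shows "c xs = 0"
proof -
  obtain us vs ws q where xs: "xs = us @ [q] @ vs @ [q] @ ws"
    using not_distinct_decomp[OF assms(2)] by blast
  have "c (q # q # (us @ vs) @ ws) = - c (q # q # (us @ vs) @ ws)"
    by (rule alternating_swap_front[OF assms(1)])
  then have 0: "c (q # q # (us @ vs) @ ws) = 0" by simp
  have "c xs = (- 1) ^ length us * c (q # us @ vs @ q # ws)"
    using alternating_move_to_front[OF assms(1), of us q "vs @ q # ws"] xs by simp
  also have "c (q # us @ vs @ q # ws) = (- 1) ^ length (us @ vs) * c (q # q # (us @ vs) @ ws)"
    using alternating_move_to_front[OF alternating_Cons[OF assms(1)], of q "us @ vs" q ws] by simp
  finally show ?thesis using 0 by simp
qed

lemma alternating_eq_0_if_front_eq_0: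
  assumes "alternating c" "\<And>ys. c (q # ys) = 0" "q \<in> set xs"
  shows "c xs = 0"
proof -
  obtain us vs where "xs = us @ q # vs" using split_list[OF assms(3)] by blast
  then show ?thesis using alternating_move_to_front[OF assms(1), of us q vs] assms(2) by simp
qed

lemma boundary_boundary:
  assumes "alternating c"
  shows "boundary S (boundary S c) ys = 0"
proof -
  have "boundary S (boundary S c) ys = (\<Sum>v\<in>S. \<Sum>u\<in>S. c (u # v # ys))"
    unfolding boundary_def ..
  also have "\<dots> = (\<Sum>v\<in>S. \<Sum>u\<in>S. - c (v # u # ys))"
    by (intro sum.cong refl) (rule alternating_swap_front[OF assms])
  also have "\<dots> = - (\<Sum>u\<in>S. \<Sum>v\<in>S. c (v # u # ys))"
    by (subst sum.swap) (simp add: sum_negf)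
  also have "\<dots> = - boundary S (boundary S c) ys"
    unfolding boundary_def ..
  finally show ?thesis by simp
qed

lemma cone_zero: "vertex_cone q (\<lambda>ys. 0) xs = 0"
  by (induction xs) auto

lemma cone_uminus: "vertex_cone q (\<lambda>ys. - g ys) xs = - vertex_cone q g xs"
  by (induction xs arbitrary: g) auto

lemma cone_add: "vertex_cone q (\<lambda>ys. f ys + g ys) xs = vertex_cone q f xs + vertex_cone q g xs"
  by (induction xs arbitrary: f g) auto

lemma cone_sum: "vertex_cone q (\<lambda>ys. \<Sum>v\<in>S. f v ys) xs = (\<Sum>v\<in>S. vertex_cone q (f v) xs)"
  by (induction S rule: infinite_finite_induct) (auto simp: cone_zero cone_add)

lemma alternating_vertex_cone:
  assumes "alternating g"
  shows "alternating (vertex_cone q g)"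
proof -
  have "vertex_cone q g (us @ a # b # vs) = - vertex_cone q g (us @ b # a # vs)" for us a b vs
    using assms
  proof (induction us arbitrary: g)
    case Nil
    have "(\<lambda>ys. g (a # b # ys)) = (\<lambda>ys. - g (b # a # ys))"
      by (intro ext) (rule alternating_swap_front[OF Nil])
    then show ?case by (simp add: cone_uminus)
  next
    case (Cons u us)
    have "g (us @ a # b # vs) = - g (us @ b # a # vs)"
      using alternating_swap[OF Cons.prems] .
    then show ?case using Cons.IH[OF alternating_Cons[OF Cons.prems, of u]] by simp
  qed
  then show ?thesis unfolding alternating_def by blast
qed

lemma cone_nonzeroD:
  "vertex_cone q g xs \<noteq> 0 \<Longrightarrow> \<exists>us vs. xs = us @ q # vs \<and> g (us @ vs) \<noteq> 0"
proof (induction xs arbitrary: g)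
  case (Cons x xs)
  show ?case
  proof (cases "x = q \<and> g xs \<noteq> 0")
    case True
    then show ?thesis by (metis append_Nil)
  next
    case False
    then have "vertex_cone q (\<lambda>ys. g (x # ys)) xs \<noteq> 0"
      using Cons.prems by (auto split: if_splits)
    from Cons.IH[OF this] show ?thesis by (metis append_Cons)
  qed
qed simp

text \<open>The usual contraction formula. It shows that a cone is acyclic, and it is what lets a
  filling in the link of \<open>q\<close> be used to push a cycle off \<open>q\<close>.\<close>
lemma boundary_cone:
  assumes "finite S" "q \<in> S"
  shows "boundary S (vertex_cone q g) ys = g ys - vertex_cone q (boundary S g) ys"
proof -
  have "boundary S (vertex_cone q g) ys
      = (\<Sum>v\<in>S. (if v = q then g ys else 0)) - (\<Sum>v\<in>S. vertex_cone q (\<lambda>zs. g (v # zs)) ys)"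
    unfolding boundary_def by (simp add: sum_subtractf)
  then show ?thesis
    using assms unfolding boundary_def by (simp add: cone_sum)
qed

section \<open>Clique complexes\<close>

text \<open>Chains of the clique complex of the graph \<open>adj\<close> on \<open>S\<close>. The number \<open>k\<close> counts vertices, so these
  are chains of dimension \<open>k - 1\<close>; for \<open>k = 0\<close> the only simplex is the empty one, and the boundary
  of a chain on single vertices is its augmentation.\<close>
definition clique_chain :: "('v \<Rightarrow> 'v \<Rightarrow> bool) \<Rightarrow> 'v set \<Rightarrow> nat \<Rightarrow> ('v list \<Rightarrow> int) \<Rightarrow> bool" where
  "clique_chain adj S k c \<longleftrightarrow> alternating c \<and>
     (\<forall>xs. c xs \<noteq> 0 \<longrightarrow> length xs = k \<and> set xs \<subseteq> S \<and> (\<forall>a\<in>set xs. \<forall>b\<in>set xs. adj a b))"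

text \<open>Vanishing of the reduced integral homology of the clique complex in dimension \<open>k - 1\<close>.\<close>
definition cycles_bound :: "('v \<Rightarrow> 'v \<Rightarrow> bool) \<Rightarrow> 'v set \<Rightarrow> nat \<Rightarrow> bool" where
  "cycles_bound adj S k \<longleftrightarrow>
     (\<forall>c. clique_chain adj S k c \<and> (\<forall>ys. boundary S c ys = 0) \<longrightarrow>
        (\<exists>h. clique_chain adj S (Suc k) h \<and> (\<forall>ys. boundary S h ys = c ys)))"

definition link :: "('v \<Rightarrow> 'v \<Rightarrow> bool) \<Rightarrow> 'v set \<Rightarrow> 'v \<Rightarrow> 'v set" where
  "link adj S q = {r \<in> S. r \<noteq> q \<and> adj q r}"

lemma clique_chainD:
  assumes "clique_chain adj S k c" "c xs \<noteq> 0"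
  shows "length xs = k" "set xs \<subseteq> S" "a \<in> set xs \<Longrightarrow> b \<in> set xs \<Longrightarrow> adj a b"
  using assms unfolding clique_chain_def by blast+

lemma clique_chain_alternating: "clique_chain adj S k c \<Longrightarrow> alternating c"
  unfolding clique_chain_def by blast

lemma clique_chainI:
  assumes "alternating c"
    and "\<And>xs. c xs \<noteq> 0 \<Longrightarrow> length xs = k \<and> set xs \<subseteq> S \<and> (\<forall>a\<in>set xs. \<forall>b\<in>set xs. adj a b)"
  shows "clique_chain adj S k c"
  using assms unfolding clique_chain_def by blast

lemma clique_chain_cong:
  assumes "\<And>a b. a \<in> S \<Longrightarrow> b \<in> S \<Longrightarrow> adj a b = adj' a b"
  shows "clique_chain adj S k = clique_chain adj' S k"
  unfolding clique_chain_def fun_eq_iff by (metis assms subsetD)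

lemma cycles_bound_cong:
  assumes "\<And>a b. a \<in> S \<Longrightarrow> b \<in> S \<Longrightarrow> adj a b = adj' a b"
  shows "cycles_bound adj S k = cycles_bound adj' S k"
proof -
  have "clique_chain adj S j = clique_chain adj' S j" for j
    by (rule clique_chain_cong) (rule assms)
  then show ?thesis unfolding cycles_bound_def by simp
qed

lemma clique_chain_add:
  assumes "clique_chain adj S k c" "clique_chain adj S k d"
  shows "clique_chain adj S k (\<lambda>xs. c xs + d xs)"
proof (rule clique_chainI)
  show "alternating (\<lambda>xs. c xs + d xs)"
    using assms by (intro alternating_add clique_chain_alternating)
  fix xs assume "c xs + d xs \<noteq> 0"
  then have "c xs \<noteq> 0 \<or> d xs \<noteq> 0" by auto
  then show "length xs = k \<and> set xs \<subseteq> S \<and> (\<forall>a\<in>set xs. \<forall>b\<in>set xs. adj a b)"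
    using clique_chainD[OF assms(1), of xs] clique_chainD[OF assms(2), of xs] by blast
qed

lemma clique_chain_diff:
  assumes "clique_chain adj S k c" "clique_chain adj S k d"
  shows "clique_chain adj S k (\<lambda>xs. c xs - d xs)"
proof (rule clique_chainI)
  show "alternating (\<lambda>xs. c xs - d xs)"
    using assms by (intro alternating_diff clique_chain_alternating)
  fix xs assume "c xs - d xs \<noteq> 0"
  then have "c xs \<noteq> 0 \<or> d xs \<noteq> 0" by auto
  then show "length xs = k \<and> set xs \<subseteq> S \<and> (\<forall>a\<in>set xs. \<forall>b\<in>set xs. adj a b)"
    using clique_chainD[OF assms(1), of xs] clique_chainD[OF assms(2), of xs] by blast
qed

lemma clique_chain_mono:
  assumes "clique_chain adj T k c" "T \<subseteq> S"
  shows "clique_chain adj S k c"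
  using assms unfolding clique_chain_def by blast

lemma clique_chain_boundary:
  assumes "clique_chain adj S (Suc k) h"
  shows "clique_chain adj S k (boundary S h)"
proof (rule clique_chainI)
  show "alternating (boundary S h)"
    using assms by (intro alternating_boundary clique_chain_alternating)
  fix ys assume "boundary S h ys \<noteq> 0"
  then obtain v where "h (v # ys) \<noteq> 0"
    unfolding boundary_def by (meson sum.neutral)
  from clique_chainD[OF assms this]
  show "length ys = k \<and> set ys \<subseteq> S \<and> (\<forall>a\<in>set ys. \<forall>b\<in>set ys. adj a b)" by simp
qed

lemma clique_chain_cone:
  assumes g: "clique_chain adj T k g" and "q \<in> S" "T \<subseteq> S"
    and "\<And>r. r \<in> T \<Longrightarrow> adj q r \<and> adj r q" "adj q q"
  shows "clique_chain adj S (Suc k) (vertex_cone q g)"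
proof (rule clique_chainI)
  show "alternating (vertex_cone q g)"
    using g by (intro alternating_vertex_cone clique_chain_alternating)
  fix xs assume "vertex_cone q g xs \<noteq> 0"
  then obtain us vs where *: "xs = us @ q # vs" "g (us @ vs) \<noteq> 0"
    using cone_nonzeroD by metis
  then have "set (us @ vs) \<subseteq> T" "\<And>a b. a \<in> set (us @ vs) \<Longrightarrow> b \<in> set (us @ vs) \<Longrightarrow> adj a b"
    "length (us @ vs) = k"
    using clique_chainD[OF g *(2)] by auto
  moreover have "set xs = insert q (set (us @ vs))" using * by auto
  ultimately show "length xs = Suc k \<and> set xs \<subseteq> S \<and> (\<forall>a\<in>set xs. \<forall>b\<in>set xs. adj a b)"
    using assms * by auto
qed

lemma boundary_subset:
  assumes "clique_chain adj T k c" "T \<subseteq> S" "finite S"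
  shows "boundary S c ys = boundary T c ys"
  unfolding boundary_def
proof (rule sum.mono_neutral_right)
  show "\<forall>v\<in>S - T. c (v # ys) = 0"
    using clique_chainD(2)[OF assms(1)] by (metis DiffD2 list.set_intros(1) subsetD)
qed (use assms in auto)

lemma cycles_bound_full:
  assumes "finite S" "q \<in> S" "\<And>a b. a \<in> S \<Longrightarrow> b \<in> S \<Longrightarrow> adj a b"
  shows "cycles_bound adj S k"
  unfolding cycles_bound_def
proof (intro allI impI, elim conjE)
  fix c assume c: "clique_chain adj S k c" and 0: "\<forall>ys. boundary S c ys = 0"
  have "boundary S c = (\<lambda>ys. 0)" using 0 by auto
  then have "boundary S (vertex_cone q c) ys = c ys" for ys
    using boundary_cone[OF assms(1,2), of c ys] by (simp add: cone_zero)
  moreover have "clique_chain adj S (Suc k) (vertex_cone q c)"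
    using clique_chain_cone[OF c] assms by blast
  ultimately show "\<exists>h. clique_chain adj S (Suc k) h \<and> (\<forall>ys. boundary S h ys = c ys)"
    by blast
qed

lemma cycles_bound_empty: "k > 0 \<Longrightarrow> cycles_bound adj {} k"
  unfolding cycles_bound_def
proof (intro allI impI, elim conjE)
  fix c assume k: "k > 0" and c: "clique_chain adj {} k c"
  have c0: "c xs = 0" for xs
  proof (rule ccontr)
    assume nz: "c xs \<noteq> 0"
    show False using clique_chainD(1,2)[OF c nz] k by simp
  qed
  show "\<exists>h. clique_chain adj {} (Suc k) h \<and> (\<forall>ys. boundary {} h ys = c ys)"
    by (rule exI[of _ "\<lambda>_. 0"]) (auto simp: clique_chain_def alternating_def boundary_def c0)
qed

text \<open>A Mayer--Vietoris step: the clique complex on \<open>S\<close> is the one on \<open>S - {q}\<close> with a cone over the link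
  of \<open>q\<close> attached. The part of a cycle around \<open>q\<close> is a cycle \<open>d\<close> in the link. If \<open>d\<close> bounds \<open>g\<close>, adding the
  boundary of the cone over \<open>g\<close> cancels all simplices at \<open>q\<close>.\<close>
lemma cycles_bound_vertex_removal:
  assumes "finite S" "q \<in> S"
    and adj_refl: "adj q q" and adj_sym: "\<And>a b. adj a b \<Longrightarrow> adj b a"
    and rest: "cycles_bound adj (S - {q}) (Suc k)"
    and lk: "cycles_bound adj (link adj S q) k"
  shows "cycles_bound adj S (Suc k)"
  unfolding cycles_bound_def
proof (intro allI impI, elim conjE)
  fix c assume c: "clique_chain adj S (Suc k) c" and dc: "\<forall>ys. boundary S c ys = 0"
  note alt = clique_chain_alternating[OF c]
  let ?L = "link adj S q"
  define d where "d = (\<lambda>ys. c (q # ys))"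
  have LS: "?L \<subseteq> S" "q \<notin> ?L" unfolding link_def by auto
  have d: "clique_chain adj ?L k d"
  proof (rule clique_chainI)
    show "alternating d" unfolding d_def by (rule alternating_Cons[OF alt])
    fix ys assume "d ys \<noteq> 0"
    then have nz: "c (q # ys) \<noteq> 0" unfolding d_def .
    have "distinct (q # ys)" using alternating_eq_0_if_not_distinct[OF alt, of "q # ys"] nz by blast
    then show "length ys = k \<and> set ys \<subseteq> ?L \<and> (\<forall>a\<in>set ys. \<forall>b\<in>set ys. adj a b)"
      using clique_chainD[OF c nz] unfolding link_def by auto
  qed
  have dd: "boundary ?L d ys = 0" for ys
  proof -
    have "boundary ?L d ys = boundary S d ys"
      using boundary_subset[OF d LS(1) assms(1)] by simp
    also have "\<dots> = - boundary S c (q # ys)"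
      unfolding boundary_def d_def sum_negf[symmetric]
      by (intro sum.cong refl) (rule alternating_swap_front[OF alt])
    finally show ?thesis using dc by simp
  qed
  obtain g where g: "clique_chain adj ?L (Suc k) g" and dg: "\<And>ys. boundary ?L g ys = d ys"
    using lk d dd unfolding cycles_bound_def by blast
  have gq: "g ys = 0" if "q \<in> set ys" for ys
    using clique_chainD(2)[OF g] LS(2) that by blast
  have dgS: "boundary S g = d"
    using boundary_subset[OF g LS(1) assms(1)] dg by auto
  define h where "h = vertex_cone q g"
  have h: "clique_chain adj S (Suc (Suc k)) h"
    unfolding h_def
    by (rule clique_chain_cone[OF g assms(2) LS(1)]) (auto simp: link_def adj_refl adj_sym)
  \<comment> \<open>The chain \<open>c'\<close> is homologous to \<open>c\<close> and contains no simplex at \<open>q\<close>.\<close>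
  define c' where "c' = (\<lambda>xs. c xs + boundary S h xs)"
  have c'S: "clique_chain adj S (Suc k) c'"
    unfolding c'_def by (rule clique_chain_add[OF c clique_chain_boundary[OF h]])
  have c'q: "c' (q # ys) = 0" for ys
  proof -
    have "boundary S h (q # ys) = g (q # ys) - vertex_cone q d (q # ys)"
      unfolding h_def boundary_cone[OF assms(1,2)] dgS ..
    also have "\<dots> = - d ys"
    proof -
      have "(\<lambda>ys. d (q # ys)) = (\<lambda>ys. 0)"
        using clique_chainD(2)[OF d] LS(2) by (metis list.set_intros(1) subsetD)
      then show ?thesis using gq[of "q # ys"] by (simp add: cone_zero)
    qed
    finally show ?thesis unfolding c'_def d_def by simp
  qed
  have c': "clique_chain adj (S - {q}) (Suc k) c'"
  proof (rule clique_chainI[OF clique_chain_alternating[OF c'S]])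
    fix xs assume nz: "c' xs \<noteq> 0"
    then have "q \<notin> set xs"
      using alternating_eq_0_if_front_eq_0[OF clique_chain_alternating[OF c'S]] c'q by blast
    then show "length xs = Suc k \<and> set xs \<subseteq> S - {q} \<and> (\<forall>a\<in>set xs. \<forall>b\<in>set xs. adj a b)"
      using clique_chainD[OF c'S nz] by auto
  qed
  have "boundary (S - {q}) c' ys = 0" for ys
  proof -
    have "boundary (S - {q}) c' ys = boundary S c' ys"
      using boundary_subset[OF c', of S] assms(1) by auto
    also have "\<dots> = boundary S c ys + boundary S (boundary S h) ys"
      unfolding c'_def boundary_def by (simp add: sum.distrib)
    finally show ?thesis
      using dc boundary_boundary[OF clique_chain_alternating[OF h]] by simp
  qed
  then obtain h' where h': "clique_chain adj (S - {q}) (Suc (Suc k)) h'"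
    and dh': "\<And>ys. boundary (S - {q}) h' ys = c' ys"
    using rest c' unfolding cycles_bound_def by blast
  have h'S: "clique_chain adj S (Suc (Suc k)) h'"
    by (rule clique_chain_mono[OF h']) auto
  have "boundary S h' ys = c' ys" for ys
    using boundary_subset[OF h', of S] assms(1) dh' by auto
  then have "boundary S (\<lambda>xs. h' xs - h xs) ys = c ys" for ys
    unfolding c'_def boundary_def by (simp add: sum_subtractf)
  then show "\<exists>h. clique_chain adj S (Suc (Suc k)) h \<and> (\<forall>ys. boundary S h ys = c ys)"
    using clique_chain_diff[OF h'S h] by blast
qed

section \<open>Valuation rings\<close>

definition unital_subring :: "'a::field set \<Rightarrow> bool" where
  "unital_subring A \<longleftrightarrow> 1 \<in> A \<and> (\<forall>x\<in>A. \<forall>y\<in>A. x - y \<in> A \<and> x * y \<in> A)"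

definition valuation_ring :: "'a::field set \<Rightarrow> bool" where
  "valuation_ring A \<longleftrightarrow> unital_subring A \<and> (\<forall>x. x \<in> A \<or> inverse x \<in> A)"

lemma unital_subringD:
  assumes "unital_subring A"
  shows "1 \<in> A" "0 \<in> A" "x \<in> A \<Longrightarrow> y \<in> A \<Longrightarrow> x - y \<in> A" "x \<in> A \<Longrightarrow> y \<in> A \<Longrightarrow> x * y \<in> A"
    "x \<in> A \<Longrightarrow> - x \<in> A" "x \<in> A \<Longrightarrow> y \<in> A \<Longrightarrow> x + y \<in> A"
proof -
  note A = assms[unfolded unital_subring_def]
  show 1: "1 \<in> A" and m: "x \<in> A \<Longrightarrow> y \<in> A \<Longrightarrow> x - y \<in> A"
    and "x \<in> A \<Longrightarrow> y \<in> A \<Longrightarrow> x * y \<in> A" for x y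
    using A by blast+
  show 0: "0 \<in> A" using m[OF 1 1] by simp
  show n: "x \<in> A \<Longrightarrow> - x \<in> A" for x using m[OF 0, of x] by simp
  show "x \<in> A \<Longrightarrow> y \<in> A \<Longrightarrow> x + y \<in> A" using m[OF _ n[of y], of x] by simp
qed

lemma unital_subring_sum:
  "unital_subring A \<Longrightarrow> (\<And>i. i \<in> I \<Longrightarrow> f i \<in> A) \<Longrightarrow> sum f I \<in> A"
  by (induction I rule: infinite_finite_induct) (auto intro: unital_subringD)

lemma unital_subring_prod:
  "unital_subring A \<Longrightarrow> (\<And>i. i \<in> I \<Longrightarrow> f i \<in> A) \<Longrightarrow> prod f I \<in> A"
  by (induction I rule: infinite_finite_induct) (auto intro: unital_subringD)

lemma unital_subring_of_int: "unital_subring A \<Longrightarrow> of_int z \<in> A"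
proof (induction z rule: int_induct[of _ 0])
  case base then show ?case by (simp add: unital_subringD)
next
  case (step1 i) then show ?case by (simp add: unital_subringD)
next
  case (step2 i) then show ?case by (simp add: unital_subringD)
qed

text \<open>Valuation rings are integrally closed; only square roots are considered here.\<close>
lemma valuation_ring_square:
  assumes "valuation_ring A" "x * x \<in> A"
  shows "x \<in> A"
proof (cases "x = 0")
  case True
  then show ?thesis using assms unital_subringD(2) unfolding valuation_ring_def by blast
next
  case False
  have sub: "unital_subring A" using assms unfolding valuation_ring_def by blast
  have "x \<in> A \<or> inverse x \<in> A" using assms unfolding valuation_ring_def by blast
  moreover have "inverse x * (x * x) = x" using False by simp
  ultimately show ?thesis using unital_subringD(4)[OF sub, of "inverse x" "x * x"] assms(2) by metis
qed

text \<open>Divisibility is a total preorder on the field, so finitely many values of \<open>f\<close> have one of least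
  valuation.\<close>
lemma valuation_ring_least_valuation:
  fixes f :: "'v \<Rightarrow> 'a::field"
  assumes "valuation_ring A" "finite S" "S \<noteq> {}"
  shows "\<exists>q\<in>S. \<forall>r\<in>S. \<exists>a\<in>A. f r = a * f q"
proof -
  have sub: "unital_subring A" using assms unfolding valuation_ring_def by blast
  note ring = unital_subringD[OF sub]
  show ?thesis
    using assms(2,3)
  proof (induction S rule: finite_ne_induct)
    case (singleton s)
    then show ?case using ring(1) by (intro bexI[of _ s] ballI bexI[of _ 1]) auto
  next
    case (insert s S)
    then obtain q where q: "q \<in> S" "\<And>r. r \<in> S \<Longrightarrow> \<exists>a\<in>A. f r = a * f q" by blast
    have "(\<exists>a\<in>A. f s = a * f q) \<or> (\<exists>a\<in>A. f q = a * f s)"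
    proof (cases "f q = 0 \<or> f s = 0")
      case True
      then show ?thesis using ring(2) by (metis mult_zero_left)
    next
      case False
      have "f s / f q \<in> A \<or> inverse (f s / f q) \<in> A"
        using assms(1) unfolding valuation_ring_def by blast
      then show ?thesis using False by (auto simp: field_simps intro: bexI[rotated])
    qed
    then show ?case
    proof
      assume "\<exists>a\<in>A. f s = a * f q"
      then show ?thesis using q by (intro bexI[of _ q]) auto
    next
      assume "\<exists>a\<in>A. f q = a * f s"
      then obtain a where a: "a \<in> A" "f q = a * f s" by blast
      have "\<exists>b\<in>A. f r = b * f s" if "r \<in> S" for r
        using q(2)[OF that] a ring(4) by (metis mult.assoc)
      moreover have "\<exists>b\<in>A. f s = b * f s" using ring(1) by (metis mult_1)
      ultimately show ?thesis by (intro bexI[of _ s]) auto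
    qed
  qed
qed

lemma unital_subring_adjoin:
  assumes "unital_subring A"
  shows "unital_subring {poly p x | p. \<forall>i. coeff p i \<in> A}" (is "unital_subring ?B")
  unfolding unital_subring_def
proof (intro conjI ballI)
  note ring = unital_subringD[OF assms]
  show "1 \<in> ?B" using ring by (intro CollectI exI[of _ 1]) auto
  fix a b assume "a \<in> ?B" "b \<in> ?B"
  then obtain p q where p: "a = poly p x" "\<And>i. coeff p i \<in> A"
    and q: "b = poly q x" "\<And>i. coeff q i \<in> A" by blast
  have "a - b = poly (p - q) x" "\<forall>i. coeff (p - q) i \<in> A" using p q ring by auto
  then show "a - b \<in> ?B" by blast
  have "a * b = poly (p * q) x" "\<forall>i. coeff (p * q) i \<in> A"
    using p q ring by (auto simp: coeff_mult intro!: unital_subring_sum[OF assms])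
  then show "a * b \<in> ?B" by blast
qed

text \<open>Chevalley's extension theorem in the form needed here: a maximal subring without \<open>V\<close> that
  contains \<open>A0\<close>, hence \<open>y = 1/V\<close>, is a valuation ring. By maximality \<open>1 - y b\<close> is a unit for every
  element \<open>b\<close>, because inverting these elements does not produce \<open>V\<close>. If neither \<open>x\<close> nor \<open>1/x\<close>
  belongs to the ring, then adjoining either of them produces \<open>V\<close>, which gives equations
  \<open>y p(x) = 1\<close> and \<open>y q(1/x) = 1\<close>. The one of lower degree can be used to lower the degree of the
  other, so a pair of equations of minimal degrees is impossible.\<close>
theorem valuation_ring_avoiding:
  fixes V :: "'a::field"
  assumes A0: "unital_subring A0" and "inverse V \<in> A0" "V \<notin> A0"
  shows "\<exists>A. valuation_ring A \<and> A0 \<subseteq> A \<and> V \<notin> A"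
proof -
  let ?\<A> = "{A. unital_subring A \<and> A0 \<subseteq> A \<and> V \<notin> A}"
  have "\<exists>M\<in>?\<A>. \<forall>X\<in>?\<A>. M \<subseteq> X \<longrightarrow> X = M"
  proof (rule subset_Zorn_nonempty)
    show "?\<A> \<noteq> {}" using assms by blast
    fix \<C> assume C: "\<C> \<noteq> {}" "subset.chain ?\<A> \<C>"
    then have C': "\<And>A. A \<in> \<C> \<Longrightarrow> unital_subring A \<and> A0 \<subseteq> A \<and> V \<notin> A"
      and lin: "\<And>A B. A \<in> \<C> \<Longrightarrow> B \<in> \<C> \<Longrightarrow> A \<subseteq> B \<or> B \<subseteq> A"
      unfolding subset_chain_def by auto
    have "unital_subring (\<Union>\<C>)"
      unfolding unital_subring_def
    proof (intro conjI ballI)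
      show "1 \<in> \<Union>\<C>" using C(1) C' unital_subringD(1) by blast
      fix x y assume "x \<in> \<Union>\<C>" "y \<in> \<Union>\<C>"
      then obtain A where A: "A \<in> \<C>" "x \<in> A" "y \<in> A" using lin by blast
      then show "x - y \<in> \<Union>\<C>" "x * y \<in> \<Union>\<C>"
        using C'[OF A(1)] unital_subringD(3,4)[of A x y] by blast+
    qed
    then show "\<Union>\<C> \<in> ?\<A>" using C(1) C' by blast
  qed
  then obtain M where M0: "M \<in> ?\<A>" and max0: "\<forall>X\<in>?\<A>. M \<subseteq> X \<longrightarrow> X = M" by (rule bexE)
  have M: "unital_subring M" "A0 \<subseteq> M" "V \<notin> M" using M0 by auto
  have max: "X = M" if "unital_subring X" "M \<subseteq> X" "V \<notin> X" for X
    using max0 that M(2) by auto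
  note ring = unital_subringD[OF M(1)]
  define y where "y = inverse V"
  have y: "y \<in> M" using assms M(2) unfolding y_def by blast
  have V0: "V \<noteq> 0" using ring(2) M(3) by blast
  have yV: "y * z = 1 \<longleftrightarrow> z = V" for z using V0 unfolding y_def by (auto simp: field_simps)
  \<comment> \<open>The fractions with denominators in \<open>1 + y M\<close> form a subring without \<open>V\<close>, as \<open>V = p / (1 - y b)\<close> would
    mean \<open>V = p + b\<close>.\<close>
  have unit: "inverse (1 - y * b) \<in> M" if b: "b \<in> M" for b
  proof -
    have nz: "1 - y * b \<noteq> 0" if "b \<in> M" for b using yV[of b] M(3) that by auto
    let ?X = "{p * inverse (1 - y * b) | p b. p \<in> M \<and> b \<in> M}"
    have XI: "p * inverse (1 - y * b) \<in> ?X" if "p \<in> M" "b \<in> M" for p b using that by blast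
    have "unital_subring ?X"
      unfolding unital_subring_def
    proof (intro conjI ballI)
      show "1 \<in> ?X" using XI[of 1 0] ring by simp
      fix s t assume "s \<in> ?X" "t \<in> ?X"
      then obtain p b p' b' where s: "s = p * inverse (1 - y * b)" "p \<in> M" "b \<in> M"
        and t: "t = p' * inverse (1 - y * b')" "p' \<in> M" "b' \<in> M" by blast
      let ?b = "b + b' - y * (b * b')"
      have bM: "?b \<in> M" using s t y ring by simp
      have b: "1 - y * ?b = (1 - y * b) * (1 - y * b')" by (simp add: algebra_simps)
      have diff: "s - t = (p * (1 - y * b') - p' * (1 - y * b)) * inverse (1 - y * ?b)"
        unfolding b s t using nz[OF s(3)] nz[OF t(3)] by (simp add: divide_simps)
      have num: "p * (1 - y * b') - p' * (1 - y * b) \<in> M"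
        using s(2,3) t(2,3) y ring by simp
      show "s - t \<in> ?X" unfolding diff by (rule XI[OF num bM])
      have mult: "s * t = (p * p') * inverse (1 - y * ?b)"
        unfolding b s t by simp
      have "p * p' \<in> M" using s(2) t(2) ring by simp
      then show "s * t \<in> ?X" unfolding mult by (rule XI[OF _ bM])
    qed
    moreover have "M \<subseteq> ?X" using XI[of _ 0] ring by auto
    moreover have "V \<notin> ?X"
    proof
      assume "V \<in> ?X"
      then obtain p b where p: "V = p * inverse (1 - y * b)" "p \<in> M" "b \<in> M" by blast
      then have "V * (1 - y * b) = p" using nz by simp
      moreover have "V * (1 - y * b) = V - b" using V0 unfolding y_def by (simp add: right_diff_distrib)
      ultimately have "V = p + b" by (metis diff_add_cancel)
      then show False using p ring M(3) by metis
    qed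
    ultimately have "?X = M" by (rule max)
    then show ?thesis using XI[of 1 b] b ring by simp
  qed
  define rep where "rep x p \<longleftrightarrow> (\<forall>i. coeff p i \<in> M) \<and> y * poly p x = 1" for x p
  have rep_ex: "\<exists>p. rep x p" if "x \<notin> M" for x
  proof (rule ccontr)
    assume none: "\<nexists>p. rep x p"
    let ?X = "{poly p x | p. \<forall>i. coeff p i \<in> M}"
    have XI: "poly p x \<in> ?X" if "\<And>i. coeff p i \<in> M" for p using that by blast
    have "M \<subseteq> ?X"
    proof
      fix a assume "a \<in> M"
      then have "coeff [:a:] i \<in> M" for i using ring by (cases i) auto
      from XI[OF this] show "a \<in> ?X" by simp
    qed
    moreover have "V \<notin> ?X" using none yV unfolding rep_def by blast
    ultimately have "?X = M" using max unital_subring_adjoin[OF M(1)] by blast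
    moreover have "coeff [:0, 1:] i \<in> M" for i using ring by (auto simp: coeff_pCons split: nat.split)
    from XI[OF this] have "x \<in> ?X" by simp
    ultimately show False using that by blast
  qed
  \<comment> \<open>Remove the constant term of \<open>q\<close> by means of the unit \<open>1 - y b\<close>; then \<open>x ^ degree p\<close> is
    expressed by lower powers of \<open>x\<close>, which eliminates the leading term of \<open>p\<close>.\<close>
  have reduce: "\<exists>p'. rep x p' \<and> degree p' < degree p"
    if p: "rep x p" and q: "rep (inverse x) q" and le: "degree q \<le> degree p" and x0: "x \<noteq> 0" for x p q
  proof -
    have pM: "\<And>i. coeff p i \<in> M" and qM: "\<And>i. coeff q i \<in> M" using p q unfolding rep_def by auto
    have deg: "degree q > 0"
    proof (rule ccontr)
      assume "\<not> degree q > 0"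
      then have "poly q (inverse x) = coeff q 0" by (simp add: poly_altdef)
      then show False using q yV qM[of 0] M(3) unfolding rep_def by metis
    qed
    define b where "b = coeff q 0"
    define u where "u = inverse (1 - y * b)"
    have u: "u \<in> M" and nz: "1 - y * b \<noteq> 0"
      using unit[of b] qM[of 0] yV[of b] M(3) unfolding u_def b_def by auto
    define q' where "q' = smult u (q - [:b:])"
    have q'M: "coeff q' i \<in> M" for i
      using ring u qM unfolding q'_def b_def by (auto simp: coeff_pCons split: nat.split)
    have "y * poly q' (inverse x) = u * (y * poly q (inverse x) - y * b)"
      unfolding q'_def by (simp add: algebra_simps)
    also have "\<dots> = 1" using q nz unfolding rep_def u_def by simp
    finally have q'1: "y * poly q' (inverse x) = 1" .
    have q'0: "coeff q' 0 = 0" unfolding q'_def b_def by simp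
    have dq': "degree q' \<le> degree p"
      using degree_smult_le[of u "q - [:b:]"] degree_diff_le[of q "degree q" "[:b:]"] le
      unfolding q'_def by simp
    have q'nz: "q' \<noteq> 0" using q'1 by auto
    have dpos: "degree q' > 0"
    proof (rule ccontr)
      assume "\<not> degree q' > 0"
      then have "lead_coeff q' = 0" using q'0 by simp
      then show False using q'nz by simp
    qed
    define r where "r = monom 1 (degree p - degree q') * reflect_poly q'"
    have rM: "coeff r i \<in> M" for i
      using q'M ring unfolding r_def by (auto simp: coeff_monom_mult coeff_reflect_poly)
    have rx: "y * poly r x = x ^ degree p"
    proof -
      have "poly r x = x ^ (degree p - degree q') * (x ^ degree q' * poly q' (inverse x))"
        unfolding r_def using x0 by (simp add: poly_monom poly_reflect_poly_nz)
      also have "\<dots> = x ^ degree p * poly q' (inverse x)"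
        using dq' by (simp flip: power_add mult.assoc)
      finally show ?thesis using q'1 by (simp add: algebra_simps)
    qed
    have rtop: "coeff r i = 0" if "i \<ge> degree p" for i
      using that q'0 dq' unfolding r_def by (auto simp: coeff_monom_mult coeff_reflect_poly)
    define p' where "p' = p - monom (lead_coeff p) (degree p) + smult (lead_coeff p * y) r"
    have "coeff p' i \<in> M" for i
      unfolding p'_def using pM rM y ring by auto
    moreover have "poly p' x = poly p x"
      unfolding p'_def using rx by (simp add: poly_monom algebra_simps)
    ultimately have "rep x p'" using p unfolding rep_def by simp
    moreover have "coeff p' i = 0" if "i > degree p - 1" for i
      using that dpos dq' rtop[of i] unfolding p'_def by (auto simp: coeff_eq_0)
    then have "degree p' \<le> degree p - 1" by (intro degree_le) auto
    then have "degree p' < degree p" using dpos dq' by simp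
    ultimately show ?thesis by blast
  qed
  have "x \<in> M \<or> inverse x \<in> M" for x
  proof (rule ccontr)
    assume "\<not> (x \<in> M \<or> inverse x \<in> M)"
    then have no: "x \<notin> M" "inverse x \<notin> M" by auto
    have x0: "x \<noteq> 0" "inverse x \<noteq> 0" using no ring(2) by auto
    obtain p where p: "rep x p" "\<And>p'. rep x p' \<Longrightarrow> degree p \<le> degree p'"
      using ex_has_least_nat[of "rep x" _ degree] rep_ex[OF no(1)] by blast
    obtain q where q: "rep (inverse x) q" "\<And>q'. rep (inverse x) q' \<Longrightarrow> degree q \<le> degree q'"
      using ex_has_least_nat[of "rep (inverse x)" _ degree] rep_ex[OF no(2)] by blast
    show False
    proof (cases "degree q \<le> degree p")
      case True
      then show False using reduce[OF p(1) q(1)] x0 p(2) by (metis not_less)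
    next
      case False
      then show False using reduce[OF q(1), of p] p(1) x0 q(2) by (metis not_less inverse_inverse_eq nat_le_linear)
    qed
  qed
  then show ?thesis using M unfolding valuation_ring_def by blast
qed

section \<open>Cliques of vectors with integral inner products\<close>

lemma scalar_product_commute: "scalar_product u v = scalar_product v (u :: 'a::field ^ 'n)"
  unfolding scalar_product_def by (simp add: mult.commute)

lemma scalar_product_left:
  fixes u v w :: "'a::field ^ 'n"
  shows "scalar_product (u + v) w = scalar_product u w + scalar_product v w"
    and "scalar_product (u - v) w = scalar_product u w - scalar_product v w"
    and "scalar_product (a *s u) w = a * scalar_product u w"
    and "scalar_product 0 w = 0"
  unfolding scalar_product_def
  by (simp_all add: distrib_right left_diff_distrib sum.distrib sum_subtractf sum_distrib_left mult.assoc)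

lemma scalar_product_right:
  fixes u v w :: "'a::field ^ 'n"
  shows "scalar_product w (u + v) = scalar_product w u + scalar_product w v"
    and "scalar_product w (u - v) = scalar_product w u - scalar_product w v"
    and "scalar_product w (a *s u) = a * scalar_product w u"
    and "scalar_product w 0 = 0"
  by (simp_all add: scalar_product_commute[of w] scalar_product_left)

text \<open>Two vectors with nonzero Gram determinant span a nondegenerate plane, and over a quadratically
  closed field this plane contains an isotropic vector, found by solving a quadratic equation.\<close>
lemma isotropic_vector_exists:
  fixes u v :: "'a::field ^ 'n"
  assumes sqrt: "\<And>z::'a. \<exists>s. s * s = z"
    and W: "vec.subspace W" "u \<in> W" "v \<in> W"
    and nondeg: "scalar_product u v * scalar_product u v \<noteq> scalar_product u u * scalar_product v v"
  shows "\<exists>w\<in>W. scalar_product w w = 0 \<and> (scalar_product u w \<noteq> 0 \<or> scalar_product v w \<noteq> 0)"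
proof (cases "scalar_product u u = 0")
  case True
  then have "scalar_product v u \<noteq> 0" using nondeg scalar_product_commute[of u v] by auto
  then show ?thesis using True W by blast
next
  case False
  define a b d where "a = scalar_product u u" and "b = scalar_product u v" and "d = scalar_product v v"
  obtain s where s: "s * s = b * b - a * d" using sqrt by blast
  have "s \<noteq> 0" using s nondeg unfolding a_def b_def d_def by auto
  have a0: "a \<noteq> 0" using False unfolding a_def .
  define c where "c = (b + s) / a"
  define w where "w = v - c *s u"
  have ca: "c * a = b + s" unfolding c_def using a0 by simp
  have "a * scalar_product w w = a * d - 2 * b * (c * a) + (c * a) * (c * a)"
    unfolding w_def a_def b_def d_def
    by (simp add: scalar_product_left scalar_product_right scalar_product_commute[of v u] algebra_simps)
  also have "\<dots> = a * d - b * b + s * s" unfolding ca by (simp add: algebra_simps)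
  also have "\<dots> = 0" unfolding s by simp
  finally have "scalar_product w w = 0" using a0 by simp
  moreover have "scalar_product u w = - s"
    using ca unfolding w_def a_def b_def by (simp add: scalar_product_right)
  moreover have "w \<in> W" unfolding w_def using W by (intro vec.subspace_diff vec.subspace_scale)
  ultimately show ?thesis using \<open>s \<noteq> 0\<close> by (intro bexI[of _ w]) auto
qed

text \<open>Splitting off a hyperbolic plane lowers the dimension by two.\<close>
lemma dim_orthogonal_hyperbolic_pair:
  fixes u w :: "'a::field ^ 'n"
  assumes W: "vec.subspace W" "u \<in> W" "w \<in> W"
    and "scalar_product w w = 0" "scalar_product u w = 1"
  defines "W' \<equiv> {v \<in> W. scalar_product v u = 0 \<and> scalar_product v w = 0}"
  shows "vec.subspace W'" "vec.dim W' + 2 \<le> vec.dim W"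
proof -
  show "vec.subspace W'"
    unfolding W'_def vec.subspace_def
    using W(1) by (auto simp: vec.subspace_def scalar_product_left)
  then have span: "vec.span W' = W'" by (rule vec.span_eq_iff[THEN iffD2])
  obtain T where T: "T \<subseteq> W'" "vec.independent T" "W' \<subseteq> vec.span T" "card T = vec.dim W'"
    using vec.basis_exists by blast
  have finT: "finite T" using T(2) by (rule vec.finiteI_independent)
  have spanT: "vec.span T \<subseteq> W'" using vec.span_mono[OF T(1)] span by simp
  have "w \<notin> vec.span T"
  proof
    assume "w \<in> vec.span T"
    then have "scalar_product w u = 0" using spanT unfolding W'_def by auto
    then show False using assms(5) scalar_product_commute[of u w] by simp
  qed
  then have ind: "vec.independent (insert w T)" using T(2) by (simp add: vec.independent_insert)
  have wperp: "vec.subspace {v. scalar_product v w = 0}"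
    unfolding vec.subspace_def by (auto simp: scalar_product_left)
  have "vec.span (insert w T) \<subseteq> {v. scalar_product v w = 0}"
    by (rule vec.span_minimal[OF _ wperp]) (use T(1) assms(4) W'_def in auto)
  then have u: "u \<notin> vec.span (insert w T)" using assms(5) by auto
  then have ind2: "vec.independent (insert u (insert w T))" using ind by (simp add: vec.independent_insert)
  have "w \<notin> T" "u \<notin> insert w T"
    using u \<open>w \<notin> vec.span T\<close> vec.span_base by blast+
  then have "card (insert u (insert w T)) = card T + 2" using finT by (simp add: card_insert_disjoint)
  moreover have "insert u (insert w T) \<subseteq> W" using T(1) W unfolding W'_def by auto
  ultimately show "vec.dim W' + 2 \<le> vec.dim W"
    using vec.independent_card_le_dim[OF _ ind2] T(4) by metis
qed

text \<open>If all pairs of vectors are joined, the complex is a simplex. Otherwise some pair has a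
  nonintegral inner product. The square of this inner product is not integral either, so it differs
  from the product of the two norms, and the Gram determinant of the pair is nonzero. Hence there is
  an isotropic vector \<open>w\<close> that is not orthogonal to all of \<open>S\<close>. Choose \<open>q\<close> such that the
  product of \<open>x q\<close> with \<open>w\<close> has the least valuation and rescale \<open>w\<close> so that this product is \<open>1\<close>.
  Now \<open>w\<close> has integral products with all vectors, and \<open>x q\<close>, \<open>w\<close> span a unimodular
  hyperbolic plane over the valuation ring. Every vector in the link of \<open>q\<close> has integral products
  with both of them; therefore projecting it to the orthogonal complement of the plane changes
  inner products only by integral amounts. Thus the link is a complex of the same kind in a space of
  dimension smaller by 2, and \<open>q\<close> can be removed.

  As \<open>k\<close> counts vertices, the reduced homology vanishes in dimensions \<open>\<ge> \<lfloor>d / 2\<rfloor>\<close> if \<open>W\<close> has dimension \<open>d\<close>.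
  This is sharp: for pairs of isotropic vectors from \<open>\<lfloor>d / 2\<rfloor>\<close> mutually orthogonal hyperbolic planes, with
  nonintegral product within each pair, the complex is the boundary of a cross-polytope.\<close>
theorem cycles_bound_integral_products:
  fixes x :: "'v \<Rightarrow> 'a::field ^ 'n"
  assumes val: "valuation_ring A" and sqrt: "\<And>z::'a. \<exists>s. s * s = z"
    and "finite S" "vec.subspace W" "x ` S \<subseteq> W" "vec.dim W < 2 * k"
    and "\<And>r. r \<in> S \<Longrightarrow> scalar_product (x r) (x r) \<in> A"
  shows "cycles_bound (\<lambda>r s. scalar_product (x r) (x s) \<in> A) S k"
  using assms(3-)
proof (induction "card S" arbitrary: S W x k rule: less_induct)
  case less
  note fin = \<open>finite S\<close> and W = \<open>vec.subspace W\<close> and xW = \<open>x ` S \<subseteq> W\<close> and dim = \<open>vec.dim W < 2 * k\<close>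
    and norm = \<open>\<And>r. r \<in> S \<Longrightarrow> scalar_product (x r) (x r) \<in> A\<close>
  let ?adj = "\<lambda>r s. scalar_product (x r) (x s) \<in> A"
  have sub: "unital_subring A" using val unfolding valuation_ring_def by blast
  note ring = unital_subringD[OF sub]
  consider "S = {}" | "S \<noteq> {}" "\<forall>r\<in>S. \<forall>s\<in>S. ?adj r s" | "\<exists>r\<in>S. \<exists>s\<in>S. \<not> ?adj r s" by blast
  then show ?case
  proof cases
    case 1
    then show ?thesis using dim by (simp add: cycles_bound_empty)
  next
    case 2
    then obtain q where "q \<in> S" by blast
    then show ?thesis by (rule cycles_bound_full[OF fin]) (use 2 in auto)
  next
    case 3
    then obtain r s where rs: "r \<in> S" "s \<in> S" "scalar_product (x r) (x s) \<notin> A" by blast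
    have "scalar_product (x r) (x s) * scalar_product (x r) (x s)
        \<noteq> scalar_product (x r) (x r) * scalar_product (x s) (x s)"
      using valuation_ring_square[OF val] ring(4)[OF norm[OF rs(1)] norm[OF rs(2)]] rs(3) by metis
    moreover have "x r \<in> W" "x s \<in> W" using rs xW by auto
    ultimately obtain w0 where w0: "w0 \<in> W" "scalar_product w0 w0 = 0"
      "scalar_product (x r) w0 \<noteq> 0 \<or> scalar_product (x s) w0 \<noteq> 0"
      using isotropic_vector_exists[OF sqrt W, of "x r" "x s"] by blast
    obtain q where q: "q \<in> S" "\<And>t. t \<in> S \<Longrightarrow> \<exists>a\<in>A. scalar_product (x t) w0 = a * scalar_product (x q) w0"
      using valuation_ring_least_valuation[OF val fin, of "\<lambda>t. scalar_product (x t) w0"] rs(1) by blast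
    have qw0: "scalar_product (x q) w0 \<noteq> 0"
    proof
      assume "scalar_product (x q) w0 = 0"
      then have "scalar_product (x t) w0 = 0" if "t \<in> S" for t using q(2)[OF that] by auto
      then show False using w0(3) rs by blast
    qed
    define w where "w = inverse (scalar_product (x q) w0) *s w0"
    have ww: "scalar_product w w = 0" and qw: "scalar_product (x q) w = 1"
      unfolding w_def using w0 qw0 by (simp_all add: scalar_product_left scalar_product_right)
    have wq: "scalar_product w (x q) = 1" using qw by (simp add: scalar_product_commute)
    have wW: "w \<in> W" unfolding w_def by (rule vec.subspace_scale[OF W w0(1)])
    have qW: "x q \<in> W" using xW q by blast
    have tw: "scalar_product (x t) w \<in> A" if t: "t \<in> S" for t
    proof -
      obtain a where a: "a \<in> A" "scalar_product (x t) w0 = a * scalar_product (x q) w0"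
        using q(2)[OF t] by blast
      then have "scalar_product (x t) w = a"
        unfolding w_def using qw0 by (simp add: scalar_product_right)
      then show ?thesis using a by simp
    qed
    define \<nu> where "\<nu> = scalar_product (x q) (x q)"
    have \<nu>: "\<nu> \<in> A" unfolding \<nu>_def using norm q by blast
    \<comment> \<open>The vector \<open>x' t\<close> is the orthogonal projection of \<open>x t\<close> along the plane spanned by \<open>x q\<close> and
      \<open>w\<close>; the coefficients solve a linear system with determinant \<open>-1\<close>, so they are integral on the link.\<close>
    define \<beta> where "\<beta> t = scalar_product (x t) (x q) - \<nu> * scalar_product (x t) w" for t
    define x' where "x' t = x t - scalar_product (x t) w *s x q - \<beta> t *s w" for t
    let ?W' = "{v \<in> W. scalar_product v (x q) = 0 \<and> scalar_product v w = 0}"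
    have perp: "scalar_product (x' t) (x q) = 0" "scalar_product (x' t) w = 0" for t
      unfolding x'_def \<beta>_def \<nu>_def
      by (simp_all add: scalar_product_left ww qw wq algebra_simps)
    have x'W: "x' t \<in> ?W'" if "t \<in> S" for t
      using perp that xW W qW wW unfolding x'_def
      by (auto intro!: vec.subspace_diff vec.subspace_scale)
    have x'x': "scalar_product (x' t) (x' u) = scalar_product (x t) (x u)
        - (scalar_product (x t) w * scalar_product (x q) (x u) + \<beta> t * scalar_product w (x u))" for t u
    proof -
      have "scalar_product (x' t) (x' u) = scalar_product (x' t) (x u)"
        using perp[of t] unfolding x'_def[of u] by (simp add: scalar_product_right)
      then show ?thesis unfolding x'_def[of t] by (simp add: scalar_product_left algebra_simps)
    qed
    let ?L = "link ?adj S q"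
    have L: "?L \<subseteq> S" "finite ?L" "card ?L < card S"
    proof -
      show "?L \<subseteq> S" unfolding link_def by auto
      then show "finite ?L" using fin finite_subset by blast
      have "?L \<subset> S" using q(1) unfolding link_def by auto
      then show "card ?L < card S" by (rule psubset_card_mono[OF fin])
    qed
    have adjL: "scalar_product (x q) (x t) \<in> A" if "t \<in> ?L" for t using that unfolding link_def by simp
    have corr: "scalar_product (x t) w * scalar_product (x q) (x u) + \<beta> t * scalar_product w (x u) \<in> A"
      if "t \<in> ?L" "u \<in> ?L" for t u
    proof -
      have "t \<in> S" "u \<in> S" using that L by auto
      have "\<beta> t \<in> A" unfolding \<beta>_def
        using adjL[OF that(1)] \<nu> tw[OF \<open>t \<in> S\<close>] ring by (simp add: scalar_product_commute[of "x t" "x q"])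
      then show ?thesis
        using tw[OF \<open>t \<in> S\<close>] tw[OF \<open>u \<in> S\<close>] adjL[OF that(2)] ring
        by (simp add: scalar_product_commute[of w "x u"])
    qed
    have eq: "scalar_product (x' t) (x' u) \<in> A \<longleftrightarrow> ?adj t u" if "t \<in> ?L" "u \<in> ?L" for t u
      using corr[OF that] ring(3)[OF _ corr[OF that]] ring(6)[OF _ corr[OF that]] x'x'[of t u]
      by (metis diff_add_cancel)
    have sub': "vec.subspace ?W'" and dim': "vec.dim ?W' + 2 \<le> vec.dim W"
      using dim_orthogonal_hyperbolic_pair[OF W qW wW ww qw] by auto
    obtain j where k: "k = Suc j" using dim by (cases k) auto
    have "cycles_bound (\<lambda>r s. scalar_product (x' r) (x' s) \<in> A) ?L j"
    proof (rule less.hyps[OF L(3) L(2) sub'])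
      show "x' ` ?L \<subseteq> ?W'" using x'W L(1) by blast
      show "vec.dim ?W' < 2 * j" using dim dim' unfolding k by simp
      show "scalar_product (x' r) (x' r) \<in> A" if "r \<in> ?L" for r
        using eq[OF that that] norm L(1) that by blast
    qed
    then have lk: "cycles_bound ?adj ?L j"
      using cycles_bound_cong[of ?L "\<lambda>r s. scalar_product (x' r) (x' s) \<in> A" ?adj j] eq by simp
    have rest: "cycles_bound ?adj (S - {q}) (Suc j)"
    proof (rule less.hyps[OF _ _ W])
      show "card (S - {q}) < card S" using card_Diff1_less[OF fin q(1)] .
      show "finite (S - {q})" using fin by simp
      show "x ` (S - {q}) \<subseteq> W" using xW by blast
      show "vec.dim W < 2 * Suc j" using dim k by simp
      show "scalar_product (x r) (x r) \<in> A" if "r \<in> S - {q}" for r using norm that by blast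
    qed
    then show ?thesis
      unfolding k
      by (intro cycles_bound_vertex_removal[OF fin q(1) norm[OF q(1)] _ rest lk])
        (simp add: scalar_product_commute)
  qed
qed

text \<open>For points joined when their squared distance is integral, the link of \<open>q\<close> is a complex of vectors
  as in the preceding theorem: take \<open>q\<close> as the origin and polarize. Points can therefore be removed
  one after the other.\<close>
theorem cycles_bound_integral_distances:
  fixes p :: "'v \<Rightarrow> 'a::field ^ 'n"
  assumes val: "valuation_ring A" and sqrt: "\<And>z::'a. \<exists>s. s * s = z"
    and half: "inverse 2 \<in> A" "(2::'a) \<noteq> 0"
    and "finite S" and "CARD('n) < 2 * k"
  shows "cycles_bound (\<lambda>u v. scalar_product (p u - p v) (p u - p v) \<in> A) S (Suc k)"
  using \<open>finite S\<close>
proof (induction S rule: finite_induct)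
  case empty
  then show ?case by (simp add: cycles_bound_empty)
next
  case (insert q S)
  let ?adj = "\<lambda>u v. scalar_product (p u - p v) (p u - p v) \<in> A"
  have sub: "unital_subring A" using val unfolding valuation_ring_def by blast
  note ring = unital_subringD[OF sub]
  have sym: "?adj u v" if "?adj v u" for u v
    using that by (simp add: scalar_product_left scalar_product_right algebra_simps)
  let ?L = "link ?adj (insert q S) q"
  define x where "x v = p v - p q" for v
  have norm: "scalar_product (x r) (x r) \<in> A" if "r \<in> ?L" for r
    using sym[of q r] that unfolding link_def x_def by blast
  have pol: "scalar_product (p u - p v) (p u - p v)
      = scalar_product (x u) (x u) + scalar_product (x v) (x v) - 2 * scalar_product (x u) (x v)" for u v
    unfolding x_def
    by (simp add: scalar_product_left scalar_product_right scalar_product_commute[of "p v" "p u"]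
        scalar_product_commute[of "p q" "p u"] scalar_product_commute[of "p q" "p v"] algebra_simps)
  have eq: "scalar_product (x u) (x v) \<in> A \<longleftrightarrow> ?adj u v" if "u \<in> ?L" "v \<in> ?L" for u v
  proof
    have "2 \<in> A" using ring(6)[OF ring(1) ring(1)] by simp
    moreover assume "scalar_product (x u) (x v) \<in> A"
    ultimately show "?adj u v" unfolding pol using norm[OF that(1)] norm[OF that(2)] ring by simp
  next
    assume uv: "?adj u v"
    have "scalar_product (x u) (x v) = inverse 2 * (scalar_product (x u) (x u)
        + scalar_product (x v) (x v) - scalar_product (p u - p v) (p u - p v))"
      unfolding pol using half(2) by simp
    also have "\<dots> \<in> A"
      using ring(4)[OF half(1) ring(3)[OF ring(6)[OF norm[OF that(1)] norm[OF that(2)]] uv]] .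
    finally show "scalar_product (x u) (x v) \<in> A" .
  qed
  have finL: "finite ?L" using insert.hyps(1) unfolding link_def by simp
  have "cycles_bound (\<lambda>r s. scalar_product (x r) (x s) \<in> A) ?L k"
    by (rule cycles_bound_integral_products[OF val sqrt finL vec.subspace_UNIV])
      (use norm assms(6) in \<open>auto simp: card_cart_basis\<close>)
  then have "cycles_bound ?adj ?L k"
    using cycles_bound_cong[of ?L "\<lambda>r s. scalar_product (x r) (x s) \<in> A" ?adj k] eq by simp
  moreover have "cycles_bound ?adj (insert q S - {q}) (Suc k)"
    using insert.IH insert.hyps(2) by simp
  moreover have "?adj q q" using ring(2) by (simp add: scalar_product_left)
  ultimately show ?case
    using insert.hyps(1) sym by (intro cycles_bound_vertex_removal[of "insert q S" q ?adj k]) auto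
qed

section \<open>Volumes of bounding cycles\<close>

lemma det_in_subring:
  fixes M :: "'a::field ^ 'n ^ 'n"
  assumes sub: "unital_subring A" and "\<And>i j. M $ i $ j \<in> A"
  shows "det M \<in> A"
  unfolding det_def
  by (intro unital_subring_sum[OF sub] unital_subringD(4)[OF sub] unital_subring_of_int[OF sub]
      unital_subring_prod[OF sub] assms(2))

text \<open>Expand by multilinearity: a term in which \<open>u\<close> occurs in two rows vanishes.\<close>
lemma det_translate_rows:
  fixes a :: "'n \<Rightarrow> 'a::comm_ring_1 ^ 'n"
  shows "det (\<chi> j. a j - u) = det (\<chi> j. a j) - (\<Sum>k\<in>UNIV. det (\<chi> j. if j = k then u else a j))"
proof -
  have clear: "det (\<chi> j. if j = k then u else if j \<in> T then a j - u else a j)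
      = det (\<chi> j. if j = k then u else a j)" if "finite T" "k \<notin> T" for k T
    using that
  proof (induction T rule: finite_induct)
    case (insert m T)
    let ?A = "\<chi> j. if j = k then u else if j \<in> T then a j - u else a j"
    have "m \<noteq> k" using insert.prems by auto
    then have "det (\<chi> j. if j = m then row m ?A + (- 1) *s row k ?A else row j ?A) = det ?A"
      by (rule det_row_operation)
    moreover have "(\<chi> j. if j = m then row m ?A + (- 1) *s row k ?A else row j ?A)
        = (\<chi> j. if j = k then u else if j \<in> insert m T then a j - u else a j)"
      using \<open>m \<noteq> k\<close> insert.hyps(2) by (auto simp: vec_eq_iff row_def)
    ultimately show ?case using insert by simp
  qed (simp cong: if_cong)
  have "det (\<chi> j. if j \<in> T then a j - u else a j)
      = det (\<chi> j. a j) - (\<Sum>k\<in>T. det (\<chi> j. if j = k then u else a j))" if "finite T" for T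
    using that
  proof (induction T rule: finite_induct)
    case (insert k T)
    let ?c = "\<lambda>j. if j \<in> T then a j - u else a j"
    have "(\<chi> j. if j \<in> insert k T then a j - u else a j) = (\<chi> j. if j = k then a j + (- 1) *s u else ?c j)"
      by (auto simp: vec_eq_iff)
    then have "det (\<chi> j. if j \<in> insert k T then a j - u else a j)
        = det (\<chi> j. if j = k then a j else ?c j) + det (\<chi> j. if j = k then (- 1) *s u else ?c j)"
      using det_row_add[of k a "\<lambda>j. (- 1) *s u" ?c] by simp
    also have "det (\<chi> j. if j = k then (- 1) *s u else ?c j) = - det (\<chi> j. if j = k then u else a j)"
      using det_row_mul[of k "- 1" "\<lambda>j. u" ?c] clear[OF insert.hyps(1,2)] by simp
    also have "(\<chi> j. if j = k then a j else ?c j) = (\<chi> j. ?c j)"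
      using insert.hyps(2) by (auto simp: vec_eq_iff)
    finally show ?case using insert by simp
  qed simp
  from this[of UNIV] show ?thesis by simp
qed

lemma det_translate_columns:
  fixes a :: "'n \<Rightarrow> 'a::comm_ring_1 ^ 'n"
  shows "det (\<chi> i j. (a j - u) $ i)
    = det (\<chi> i j. a j $ i) - (\<Sum>k\<in>UNIV. det (\<chi> i j. (if j = k then u else a j) $ i))"
proof -
  have tr: "det (\<chi> i j. b j $ i) = det (\<chi> j. b j)" for b :: "'n \<Rightarrow> 'a ^ 'n"
    using det_transpose[of "\<chi> j. b j"] by (simp add: transpose_def)
  show ?thesis unfolding tr by (rule det_translate_rows)
qed

text \<open>Up to the factor \<open>n!\<close>, the oriented volume of the simplex with apex \<open>base\<close> over \<open>xs\<close>. The value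
  0 on lists of other lengths makes it alternating on all lists.\<close>
definition cone_det :: "('n \<Rightarrow> nat) \<Rightarrow> ('v \<Rightarrow> 'a::comm_ring_1 ^ 'n) \<Rightarrow> 'a ^ 'n \<Rightarrow> 'v list \<Rightarrow> 'a" where
  "cone_det e p base xs =
     (if length xs = CARD('n) then det (\<chi> i j. (p (xs ! e j) - base) $ i) else 0)"

lemma alternating_cone_det:
  fixes p :: "'v \<Rightarrow> 'a::comm_ring_1 ^ 'n"
  assumes e: "bij_betw e UNIV {..<CARD('n)}"
  shows "alternating (cone_det e p base)"
  unfolding alternating_def
proof (intro allI)
  fix us vs :: "'v list" and a b
  let ?xs = "us @ a # b # vs" and ?ys = "us @ b # a # vs"
  show "cone_det e p base ?xs = - cone_det e p base ?ys"
  proof (cases "length ?xs = CARD('n)")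
    case True
    then have "length us \<in> e ` UNIV" "Suc (length us) \<in> e ` UNIV"
      using e by (auto simp: bij_betw_def)
    then obtain i j where ij: "e i = length us" "e j = Suc (length us)" by force
    then have "i \<noteq> j" by auto
    have inj: "e k = e l \<longleftrightarrow> k = l" for k l using e by (auto simp: bij_betw_def inj_eq)
    let ?\<tau> = "Transposition.transpose i j"
    have "?xs ! e k = ?ys ! e (?\<tau> k)" for k
    proof -
      consider "k = i" | "k = j" | "k \<noteq> i" "k \<noteq> j" by blast
      then show ?thesis
      proof cases
        case 3
        then have "e k \<noteq> length us" "e k \<noteq> Suc (length us)" using inj[of k i] inj[of k j] ij by auto
        then show ?thesis using 3 by (auto simp: nth_append nth_Cons' transpose_apply_other)
      qed (auto simp: ij nth_append)
    qed
    then have "det (\<chi> k l. (p (?xs ! e l) - base) $ k)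
        = det (\<chi> k l. (\<chi> k l. (p (?ys ! e l) - base) $ k) $ k $ ?\<tau> l :: 'a ^ 'n ^ 'n)"
      by simp
    also have "\<dots> = - det (\<chi> k l. (p (?ys ! e l) - base) $ k)"
      by (subst det_permute_columns) (auto simp: permutes_swap_id sign_swap_id \<open>i \<noteq> j\<close>)
    finally show ?thesis using True unfolding cone_det_def by simp
  qed (simp add: cone_det_def)
qed

lemma alternating_swap_first:
  assumes "alternating c"
  shows "c (v # us @ a # vs) = - c (a # us @ v # vs)"
proof -
  have "c (v # us @ a # vs) = (- 1) ^ length us * c (v # a # us @ vs)"
    by (rule alternating_move_to_front[OF alternating_Cons[OF assms]])
  also have "\<dots> = - ((- 1) ^ length us * c (a # v # us @ vs))"
    using alternating_swap_front[OF assms, of v a "us @ vs"] by simp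
  also have "(- 1) ^ length us * c (a # v # us @ vs) = c (a # us @ v # vs)"
    by (rule alternating_move_to_front[OF alternating_Cons[OF assms], symmetric])
  finally show ?thesis .
qed

abbreviation words :: "'v set \<Rightarrow> nat \<Rightarrow> 'v list set" where
  "words S k \<equiv> {xs. set xs \<subseteq> S \<and> length xs = k}"

text \<open>Exchanging the first vertex of a simplex of \<open>h\<close> with another one changes the sign of its
  coefficient.\<close>
lemma sum_chain_exchange:
  fixes D :: "'v list \<Rightarrow> 'a::field"
  assumes "alternating h" "finite S" "k < n"
  shows "(\<Sum>xs\<in>words S n. \<Sum>v\<in>S. of_int (h (v # xs)) * D (xs[k := v]))
    = - (\<Sum>xs\<in>words S n. \<Sum>v\<in>S. of_int (h (v # xs)) * D xs)"
proof -
  have "(\<Sum>xs\<in>words S n. \<Sum>v\<in>S. of_int (h (v # xs)) * D (xs[k := v]))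
      = (\<Sum>(xs, v)\<in>words S n \<times> S. of_int (h (v # xs)) * D (xs[k := v]))"
    by (rule sum.cartesian_product)
  also have "\<dots> = (\<Sum>(xs, v)\<in>words S n \<times> S. - (of_int (h (v # xs)) * D xs))"
  proof -
    let ?F = "\<lambda>(xs, v). (xs[k := v], xs ! k)"
    have FF: "?F (?F z) = z" and F: "?F z \<in> words S n \<times> S"
      and hF: "(case ?F z of (xs, v) \<Rightarrow> - (of_int (h (v # xs)) * D xs))
        = (case z of (xs, v) \<Rightarrow> of_int (h (v # xs)) * D (xs[k := v]))"
      if zin: "z \<in> words S n \<times> S" for z
    proof -
      obtain xs v where z: "z = (xs, v)" "set xs \<subseteq> S" "length xs = n" "v \<in> S" using zin by auto
      then have k: "k < length xs" using assms by simp
      show "?F (?F z) = z" using z k by simp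
      have "set (xs[k := v]) \<subseteq> S" using z set_update_subsetI by metis
      then show "?F z \<in> words S n \<times> S" using z k nth_mem[of k xs] by auto
      have "h (v # take k xs @ xs ! k # drop (Suc k) xs) = - h (xs ! k # take k xs @ v # drop (Suc k) xs)"
        by (rule alternating_swap_first[OF assms(1)])
      then have "h (v # xs) = - h (xs ! k # xs[k := v])"
        using k id_take_nth_drop[OF k] by (simp add: upd_conv_take_nth_drop)
      then show "(case ?F z of (xs, v) \<Rightarrow> - (of_int (h (v # xs)) * D xs))
          = (case z of (xs, v) \<Rightarrow> of_int (h (v # xs)) * D (xs[k := v]))"
        using z k by simp
    qed
    show ?thesis by (rule sum.reindex_bij_witness[of _ ?F ?F]) (fact FF F hF)+
  qed
  also have "\<dots> = - (\<Sum>xs\<in>words S n. \<Sum>v\<in>S. of_int (h (v # xs)) * D xs)"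
    by (simp add: sum.cartesian_product sum_negf case_prod_beta)
  finally show ?thesis .
qed

text \<open>The square of the determinant is the Gram determinant of the edge vectors at \<open>v\<close>, whose entries
  are half-integral combinations of squared edge lengths.\<close>
lemma simplex_det_integral:
  fixes p :: "'v \<Rightarrow> 'a::field ^ 'n"
  assumes val: "valuation_ring A" and half: "inverse 2 \<in> A" "(2::'a) \<noteq> 0"
    and dist: "\<And>u w. u \<in> insert v (set xs) \<Longrightarrow> w \<in> insert v (set xs) \<Longrightarrow>
      scalar_product (p u - p w) (p u - p w) \<in> A"
    and len: "length xs = CARD('n)" and e: "bij_betw e UNIV {..<CARD('n)}"
  shows "det (\<chi> i j. (p (xs ! e j) - p v) $ i) \<in> A"
proof (rule valuation_ring_square[OF val])
  have sub: "unital_subring A" using val unfolding valuation_ring_def by blast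
  note ring = unital_subringD[OF sub]
  let ?M = "\<chi> i j. (p (xs ! e j) - p v) $ i"
  have pol: "scalar_product (a - c) (b - c) = inverse 2 * (scalar_product (a - c) (a - c)
      + scalar_product (b - c) (b - c) - scalar_product (a - b) (a - b))" for a b c :: "'a ^ 'n"
  proof -
    have "scalar_product (a - b) (a - b) = scalar_product (a - c) (a - c)
      + scalar_product (b - c) (b - c) - 2 * scalar_product (a - c) (b - c)"
      by (simp add: scalar_product_left scalar_product_right scalar_product_commute[of b a]
          scalar_product_commute[of c a] scalar_product_commute[of c b] algebra_simps)
    then show ?thesis using half(2) by simp
  qed
  have "(transpose ?M ** ?M) $ i $ j \<in> A" for i j
  proof -
    have "e i < length xs" "e j < length xs" using e len unfolding bij_betw_def by auto
    then have mem: "xs ! e i \<in> insert v (set xs)" "xs ! e j \<in> insert v (set xs)" "v \<in> insert v (set xs)"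
      by auto
    have "(transpose ?M ** ?M) $ i $ j = scalar_product (p (xs ! e i) - p v) (p (xs ! e j) - p v)"
      by (simp add: matrix_matrix_mult_def transpose_def scalar_product_def)
    also have "\<dots> \<in> A"
      unfolding pol[of "p (xs ! e i)" "p v" "p (xs ! e j)"]
      using ring(4)[OF half(1) ring(3)[OF ring(6)[OF dist[OF mem(1,3)] dist[OF mem(2,3)]] dist[OF mem(1,2)]]] .
    finally show ?thesis .
  qed
  then have "det (transpose ?M ** ?M) \<in> A" by (rule det_in_subring[OF sub])
  then show "det ?M * det ?M \<in> A" by (simp only: det_mul det_transpose)
qed

text \<open>The volume of the boundary of \<open>h\<close> is the sum of the volumes of the simplices of \<open>h\<close>, and these are
  integral. By \<open>det_translate_columns\<close> the determinant of a simplex is a signed sum of \<open>n + 1\<close> cone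
  determinants, one for each facet; after summation over all vertex lists each of them contributes
  the same amount \<open>T\<close>, by \<open>sum_chain_exchange\<close>. This is the origin of the factor \<open>n + 1\<close>.\<close>
theorem boundary_volume_integral:
  fixes p :: "'v \<Rightarrow> 'a::field ^ 'n"
  assumes val: "valuation_ring A" and half: "inverse 2 \<in> A" "(2::'a) \<noteq> 0"
    and e: "bij_betw e UNIV {..<CARD('n)}" and "finite S"
    and h: "clique_chain (\<lambda>u w. scalar_product (p u - p w) (p u - p w) \<in> A) S (Suc CARD('n)) h"
  shows "of_nat (Suc CARD('n)) *
    (\<Sum>xs\<in>words S CARD('n). of_int (boundary S h xs) * cone_det e p base xs) \<in> A"
proof -
  let ?n = "CARD('n)"
  let ?D = "cone_det e p base"
  let ?E = "\<lambda>v xs. det (\<chi> i j. (p (xs ! e j) - p v) $ i)"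
  have sub: "unital_subring A" using val unfolding valuation_ring_def by blast
  have inj: "e k = e l \<longleftrightarrow> k = l" for k l using e by (auto simp: bij_betw_def inj_eq)
  have elt: "e k < ?n" for k using e by (auto simp: bij_betw_def)
  define T where "T = (\<Sum>xs\<in>words S ?n. \<Sum>v\<in>S. of_int (h (v # xs)) * ?D xs)"
  have E: "?E v xs = ?D xs - (\<Sum>k\<in>UNIV. ?D (xs[e k := v]))" if "length xs = ?n" for v xs
  proof -
    have "?E v xs = det (\<chi> i j. ((p (xs ! e j) - base) - (p v - base)) $ i)" by simp
    also have "\<dots> = det (\<chi> i j. (p (xs ! e j) - base) $ i)
        - (\<Sum>k\<in>UNIV. det (\<chi> i j. (if j = k then p v - base else p (xs ! e j) - base) $ i))"
      by (rule det_translate_columns)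
    also have "(\<lambda>k. det (\<chi> i j. (if j = k then p v - base else p (xs ! e j) - base) $ i))
        = (\<lambda>k. ?D (xs[e k := v]))"
    proof
      fix k
      have "p (xs[e k := v] ! e j) - base = (if j = k then p v - base else p (xs ! e j) - base)" for j
        using elt that inj[of k j] by auto
      then show "det (\<chi> i j. (if j = k then p v - base else p (xs ! e j) - base) $ i) = ?D (xs[e k := v])"
        using that unfolding cone_det_def by simp
    qed
    finally show ?thesis using that unfolding cone_det_def by simp
  qed
  have "(\<Sum>xs\<in>words S ?n. \<Sum>v\<in>S. of_int (h (v # xs)) * ?E v xs)
      = T - (\<Sum>xs\<in>words S ?n. \<Sum>v\<in>S. \<Sum>k\<in>UNIV. of_int (h (v # xs)) * ?D (xs[e k := v]))"
  proof -
    have "(\<Sum>xs\<in>words S ?n. \<Sum>v\<in>S. of_int (h (v # xs)) * ?E v xs)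
        = (\<Sum>xs\<in>words S ?n. \<Sum>v\<in>S. of_int (h (v # xs)) * ?D xs
            - (\<Sum>k\<in>UNIV. of_int (h (v # xs)) * ?D (xs[e k := v])))"
      by (intro sum.cong refl, subst E) (simp_all add: right_diff_distrib sum_distrib_left)
    then show ?thesis unfolding T_def by (simp add: sum_subtractf)
  qed
  also have "(\<Sum>xs\<in>words S ?n. \<Sum>v\<in>S. \<Sum>k\<in>UNIV. of_int (h (v # xs)) * ?D (xs[e k := v]))
      = (\<Sum>k\<in>UNIV. \<Sum>xs\<in>words S ?n. \<Sum>v\<in>S. of_int (h (v # xs)) * ?D (xs[e k := v]))"
    by (subst (2) sum.swap, subst sum.swap) simp
  also have "\<dots> = (\<Sum>k\<in>(UNIV::'n set). - T)"
    unfolding T_def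
    by (intro sum.cong refl sum_chain_exchange[OF clique_chain_alternating[OF h] \<open>finite S\<close> elt])
  also have "T - \<dots> = of_nat (Suc ?n) * T" by (simp add: algebra_simps)
  finally have "of_nat (Suc ?n) * T = (\<Sum>xs\<in>words S ?n. \<Sum>v\<in>S. of_int (h (v # xs)) * ?E v xs)" ..
  also have "\<dots> \<in> A"
  proof (intro unital_subring_sum[OF sub])
    fix xs v assume xs: "xs \<in> words S ?n" and v: "v \<in> S"
    show "of_int (h (v # xs)) * ?E v xs \<in> A"
    proof (cases "h (v # xs) = 0")
      case True
      then show ?thesis using unital_subringD(2)[OF sub] by simp
    next
      case False
      have "?E v xs \<in> A"
        using simplex_det_integral[OF val half _ _ e, of v xs p] clique_chainD(3)[OF h False] xs by simp
      then show ?thesis by (intro unital_subringD(4)[OF sub] unital_subring_of_int[OF sub])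
    qed
  qed
  also have "T = (\<Sum>xs\<in>words S ?n. of_int (boundary S h xs) * ?D xs)"
    unfolding T_def boundary_def by (simp add: sum_distrib_right)
  finally show ?thesis .
qed

section \<open>The fundamental cycle of an oriented pseudo-manifold\<close>

definition fundamental_chain :: "'v set set \<Rightarrow> nat \<Rightarrow> 'v list set \<Rightarrow> 'v list \<Rightarrow> int" where
  "fundamental_chain K k \<Omega> xs =
     (if distinct xs \<and> set xs \<in> simplices K k then (if xs \<in> \<Omega> then 1 else - 1) else 0)"

lemma face_in_complex:
  "simplicial_complex K \<Longrightarrow> \<sigma> \<in> K \<Longrightarrow> \<tau> \<noteq> {} \<Longrightarrow> \<tau> \<subseteq> \<sigma> \<Longrightarrow> \<tau> \<in> K"
  unfolding simplicial_complex_def by blast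

lemma adjacent_swap_orientation:
  assumes "simplex_orientations K k \<Omega>" "distinct (us @ a # b # vs)" "set (us @ a # b # vs) \<in> simplices K k"
  shows "us @ a # b # vs \<in> \<Omega> \<longleftrightarrow> us @ b # a # vs \<notin> \<Omega>"
proof -
  let ?xs = "us @ b # a # vs" and ?i = "length us"
  let ?p = "Transposition.transpose ?i (Suc ?i)"
  have "set ?xs = set (us @ a # b # vs)" by auto
  then have 1: "set ?xs \<in> simplices K k" "?xs \<in> orderings (set ?xs)"
    using assms(2,3) unfolding orderings_def by auto
  have 2: "?p permutes {..<length ?xs}" by (rule permutes_swap_id) auto
  have "permute_list ?p ?xs = us @ a # b # vs"
  proof (rule nth_equalityI)
    fix j assume "j < length (permute_list ?p ?xs)"
    then have "permute_list ?p ?xs ! j = ?xs ! ?p j" using 2 by (simp add: permute_list_nth)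
    also have "\<dots> = (us @ a # b # vs) ! j"
      by (cases "j = ?i"; cases "j = Suc ?i")
        (auto simp: nth_append nth_Cons' transpose_apply_other)
    finally show "permute_list ?p ?xs ! j = (us @ a # b # vs) ! j" .
  qed simp
  moreover have "\<not> evenperm ?p" by (simp add: evenperm_swap)
  moreover have "permute_list ?p ?xs \<in> \<Omega> \<longleftrightarrow> (if evenperm ?p then ?xs \<in> \<Omega> else ?xs \<notin> \<Omega>)"
    using assms(1) 1 2 unfolding simplex_orientations_def by blast
  ultimately show ?thesis by simp
qed

lemma alternating_fundamental_chain:
  assumes "simplex_orientations K k \<Omega>"
  shows "alternating (fundamental_chain K k \<Omega>)"
  unfolding alternating_def
proof (intro allI)
  fix us vs :: "'a list" and a b
  have set: "set (us @ b # a # vs) = set (us @ a # b # vs)" by auto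
  have dist: "distinct (us @ b # a # vs) = distinct (us @ a # b # vs)" by auto
  show "fundamental_chain K k \<Omega> (us @ a # b # vs) = - fundamental_chain K k \<Omega> (us @ b # a # vs)"
    unfolding fundamental_chain_def set dist
    using adjacent_swap_orientation[OF assms, of us a b vs] by simp
qed

lemma fundamental_chain_cycle:
  assumes pm: "pseudo_manifold K k" and or: "consistent_orientation K k \<Omega>"
    and "finite K" and k: "k > 0"
  shows "boundary (\<Union>K) (fundamental_chain K k \<Omega>) ys = 0"
proof -
  let ?c = "fundamental_chain K k \<Omega>"
  let ?\<rho> = "set ys"
  have sc: "simplicial_complex K" using pm unfolding pseudo_manifold_def by blast
  have fin: "finite (\<Union>K)" using sc \<open>finite K\<close> unfolding simplicial_complex_def by blast
  define N where "N = {v. v \<notin> ?\<rho> \<and> insert v ?\<rho> \<in> simplices K k}"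
  have NK: "N \<subseteq> \<Union>K" unfolding N_def simplices_def by auto
  show ?thesis
  proof (cases "distinct ys \<and> ?\<rho> \<in> simplices K (k - 1)")
    case False
    have "?c (v # ys) = 0" for v
    proof (rule ccontr)
      assume "?c (v # ys) \<noteq> 0"
      then have v: "distinct (v # ys)" "insert v ?\<rho> \<in> K" "card (insert v ?\<rho>) = Suc k"
        unfolding fundamental_chain_def simplices_def by (auto split: if_splits)
      then have "card ?\<rho> = k" by simp
      moreover from this have "?\<rho> \<noteq> {}" using k by auto
      then have "?\<rho> \<in> K" using face_in_complex[OF sc v(2)] by blast
      ultimately show False using False v(1) k unfolding simplices_def by simp
    qed
    then show ?thesis unfolding boundary_def by simp
  next
    case True
    have "{\<sigma> \<in> simplices K k. ?\<rho> \<subseteq> \<sigma>} = (\<lambda>v. insert v ?\<rho>) ` N"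
    proof (intro equalityI subsetI)
      fix \<sigma> assume \<sigma>: "\<sigma> \<in> {\<sigma> \<in> simplices K k. ?\<rho> \<subseteq> \<sigma>}"
      have "card ?\<rho> = k" using True k unfolding simplices_def by simp
      moreover have "card \<sigma> = Suc k" "finite \<sigma>"
        using \<sigma> sc unfolding simplices_def simplicial_complex_def by auto
      ultimately have "card (\<sigma> - ?\<rho>) = 1" using \<sigma> by (simp add: card_Diff_subset)
      then obtain v where v: "\<sigma> - ?\<rho> = {v}" by (meson card_1_singletonE)
      then have "\<sigma> = insert v ?\<rho>" "v \<notin> ?\<rho>" using \<sigma> by auto
      then show "\<sigma> \<in> (\<lambda>v. insert v ?\<rho>) ` N" using \<sigma> unfolding N_def by auto
    qed (auto simp: N_def)
    moreover have "inj_on (\<lambda>v. insert v ?\<rho>) N" unfolding inj_on_def N_def by blast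
    moreover have "card {\<sigma> \<in> simplices K k. ?\<rho> \<subseteq> \<sigma>} = 2"
      using pm True unfolding pseudo_manifold_def by blast
    ultimately have "card N = 2" by (simp add: card_image)
    then obtain a b where ab: "N = {a, b}" "a \<noteq> b" by (meson card_2_iff)
    have "boundary (\<Union>K) ?c ys = (\<Sum>v\<in>N. ?c (v # ys))"
      unfolding boundary_def
      by (rule sum.mono_neutral_right[OF fin NK]) (auto simp: N_def fundamental_chain_def)
    also have "\<dots> = ?c (a # ys) + ?c (b # ys)" using ab by simp
    also have "\<dots> = 0"
    proof -
      have "a \<notin> ?\<rho>" "b \<notin> ?\<rho>" "insert a ?\<rho> \<in> simplices K k" "insert b ?\<rho> \<in> simplices K k"
        using ab(1) unfolding N_def by auto
      moreover from this have "a # ys \<in> \<Omega> \<longleftrightarrow> b # ys \<notin> \<Omega>"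
        using or True ab(2) unfolding consistent_orientation_def orderings_def by blast
      ultimately show ?thesis using True unfolding fundamental_chain_def by simp
    qed
    finally show ?thesis .
  qed
qed

lemma positive_ordering_exists:
  assumes "simplex_orientations K k \<Omega>" "simplicial_complex K" "\<sigma> \<in> simplices K k" "k > 0"
  shows "\<exists>xs. xs \<in> orderings \<sigma> \<and> xs \<in> \<Omega>"
proof -
  have fin: "finite \<sigma>" and card: "card \<sigma> = Suc k"
    using assms unfolding simplicial_complex_def simplices_def by auto
  then obtain xs where xs: "set xs = \<sigma>" "distinct xs" using finite_distinct_list by blast
  then have "length xs = Suc k" using card distinct_card by metis
  then obtain a b vs where ab: "xs = a # b # vs" using assms(4) by (cases xs; cases "tl xs") auto
  have "[] @ a # b # vs \<in> \<Omega> \<longleftrightarrow> [] @ b # a # vs \<notin> \<Omega>"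
    using adjacent_swap_orientation[OF assms(1), of "[]"] xs assms(3) unfolding ab by simp
  moreover have "b # a # vs \<in> orderings \<sigma>" "xs \<in> orderings \<sigma>"
    using xs unfolding ab orderings_def by auto
  ultimately show ?thesis unfolding ab by auto
qed

text \<open>Adjacent swaps generate all rearrangements.\<close>
lemma symmetric_mset_eq:
  assumes swap: "\<And>us a b vs. f (us @ a # b # vs) = f (us @ b # a # vs)" and "mset xs = mset ys"
  shows "f xs = f ys"
proof -
  have front: "f (ws @ us @ a # vs) = f (ws @ a # us @ vs)" for ws us a vs
  proof (induction us arbitrary: vs rule: rev_induct)
    case (snoc u us)
    show ?case using swap[of "ws @ us" u a vs] snoc.IH[of "u # vs"] by simp
  qed simp
  have "f (ws @ xs) = f (ws @ ys)" for ws
    using assms(2)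
  proof (induction xs arbitrary: ws ys)
    case (Cons x xs)
    then have "x \<in> set ys" by (metis list.set_intros(1) mset_eq_setD)
    then obtain us vs where ys: "ys = us @ x # vs" by (meson split_list)
    then have "mset xs = mset (us @ vs)" using Cons.prems by simp
    then have "f ((ws @ [x]) @ xs) = f ((ws @ [x]) @ us @ vs)" by (rule Cons.IH)
    then show ?case using front[of ws us x vs] unfolding ys by simp
  qed simp
  from this[of "[]"] show ?thesis by simp
qed

text \<open>The \<open>n!\<close> orderings of a simplex contribute equally, since the sign of its coefficient and the
  sign of the determinant change simultaneously.\<close>
lemma fundamental_chain_pairing:
  fixes D :: "'v list \<Rightarrow> 'a::field"
  assumes sc: "simplicial_complex K" and or: "simplex_orientations K k \<Omega>" and "finite K" and k: "k > 0"
    and D: "alternating D"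
  shows "(\<Sum>xs\<in>words (\<Union>K) (Suc k). of_int (fundamental_chain K k \<Omega> xs) * D xs)
    = of_nat (fact (Suc k)) * (\<Sum>\<sigma>\<in>simplices K k. D (SOME xs. xs \<in> orderings \<sigma> \<and> xs \<in> \<Omega>))"
proof -
  let ?c = "fundamental_chain K k \<Omega>"
  let ?f = "\<lambda>xs. of_int (?c xs) * D xs"
  have fin: "finite (\<Union>K)" using sc \<open>finite K\<close> unfolding simplicial_complex_def by blast
  have sfin: "finite \<sigma>" "card \<sigma> = Suc k" "\<sigma> \<subseteq> \<Union>K" if "\<sigma> \<in> simplices K k" for \<sigma>
    using that sc unfolding simplicial_complex_def simplices_def by auto
  have len: "length xs = card \<sigma>" if "xs \<in> orderings \<sigma>" for xs :: "'v list" and \<sigma>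
    using that distinct_card unfolding orderings_def by fastforce
  have swap: "?f (us @ a # b # vs) = ?f (us @ b # a # vs)" for us a b vs
    using alternating_swap[OF alternating_fundamental_chain[OF or], of us a b vs]
      alternating_swap[OF D, of us a b vs] by simp
  have sub: "(\<Union>\<sigma>\<in>simplices K k. orderings \<sigma>) \<subseteq> words (\<Union>K) (Suc k)"
    using len sfin unfolding orderings_def by fastforce
  have finw: "finite (words (\<Union>K) (Suc k))" using finite_lists_length_eq[OF fin] .
  have "(\<Sum>xs\<in>words (\<Union>K) (Suc k). ?f xs) = (\<Sum>xs\<in>(\<Union>\<sigma>\<in>simplices K k. orderings \<sigma>). ?f xs)"
    by (rule sum.mono_neutral_right[OF finw sub]) (auto simp: fundamental_chain_def orderings_def)
  also have "\<dots> = (\<Sum>\<sigma>\<in>simplices K k. \<Sum>xs\<in>orderings \<sigma>. ?f xs)"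
  proof (rule sum.UNION_disjoint)
    show "finite (simplices K k)" using \<open>finite K\<close> unfolding simplices_def by simp
    show "\<forall>\<sigma>\<in>simplices K k. finite (orderings \<sigma>)"
      using sub finw by (meson UN_upper finite_subset)
    show "\<forall>\<sigma>\<in>simplices K k. \<forall>\<tau>\<in>simplices K k. \<sigma> \<noteq> \<tau> \<longrightarrow> orderings \<sigma> \<inter> orderings \<tau> = {}"
      unfolding orderings_def by auto
  qed
  also have "\<dots> = (\<Sum>\<sigma>\<in>simplices K k. of_nat (fact (Suc k)) * D (SOME xs. xs \<in> orderings \<sigma> \<and> xs \<in> \<Omega>))"
  proof (rule sum.cong[OF refl])
    fix \<sigma> assume \<sigma>: "\<sigma> \<in> simplices K k"
    define zs where "zs = (SOME xs. xs \<in> orderings \<sigma> \<and> xs \<in> \<Omega>)"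
    have zs: "zs \<in> orderings \<sigma>" "zs \<in> \<Omega>"
      using someI_ex[OF positive_ordering_exists[OF or sc \<sigma> k]] unfolding zs_def by auto
    have "?f xs = D zs" if "xs \<in> orderings \<sigma>" for xs
    proof -
      have "mset xs = mset zs"
        using that zs unfolding orderings_def by (metis (mono_tags, lifting) mem_Collect_eq set_eq_iff_mset_eq_distinct)
      then have "?f xs = ?f zs" by (rule symmetric_mset_eq[of ?f, OF swap])
      also have "?c zs = 1" using zs \<sigma> unfolding fundamental_chain_def orderings_def by auto
      finally show ?thesis by simp
    qed
    then have "(\<Sum>xs\<in>orderings \<sigma>. ?f xs) = of_nat (card (orderings \<sigma>)) * D zs" by simp
    moreover have "orderings \<sigma> = permutations_of_set \<sigma>"
      unfolding orderings_def permutations_of_set_def by auto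
    then have "card (orderings \<sigma>) = fact (Suc k)" using sfin(1,2)[OF \<sigma>] by (simp del: fact_Suc)
    ultimately show "(\<Sum>xs\<in>orderings \<sigma>. ?f xs)
        = of_nat (fact (Suc k)) * D (SOME xs. xs \<in> orderings \<sigma> \<and> xs \<in> \<Omega>)"
      unfolding zs_def by simp
  qed
  finally show ?thesis by (simp add: sum_distrib_left)
qed

text \<open>The fundamental cycle has dimension \<open>n - 1\<close>. Since \<open>\<lfloor>n / 2\<rfloor> + 1 \<le> n - 1\<close> for \<open>n \<ge> 3\<close>, it
  bounds in the complex of points with integral squared distances. For \<open>n = 2\<close> the inequality fails, in
  accordance with the flexible quadrilaterals in the plane.\<close>
theorem pseudo_manifold_volume_integral:
  fixes p :: "'v \<Rightarrow> 'a::field ^ 'n"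
  assumes val: "valuation_ring A" and half: "inverse 2 \<in> A" "(2::'a) \<noteq> 0"
    and sqrt: "\<And>z::'a. \<exists>s. s * s = z"
    and n: "CARD('n) \<ge> 3" and e: "bij_betw e UNIV {..<CARD('n)}" and "finite K"
    and pm: "pseudo_manifold K (CARD('n) - 1)" and or: "consistent_orientation K (CARD('n) - 1) \<Omega>"
    and edges: "\<And>u v. {u, v} \<in> simplices K 1 \<Longrightarrow> scalar_product (p u - p v) (p u - p v) \<in> A"
  shows "of_nat (Suc CARD('n)) * (of_nat (fact CARD('n)) * (\<Sum>\<sigma>\<in>simplices K (CARD('n) - 1).
    cone_det e p base (SOME xs. xs \<in> orderings \<sigma> \<and> xs \<in> \<Omega>))) \<in> A"
proof -
  let ?adj = "\<lambda>u v. scalar_product (p u - p v) (p u - p v) \<in> A"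
  obtain m where m: "CARD('n) = Suc m" "m \<ge> 2" using n by (cases "CARD('n)") auto
  let ?c = "fundamental_chain K m \<Omega>"
  have sub: "unital_subring A" using val unfolding valuation_ring_def by blast
  have sc: "simplicial_complex K" using pm unfolding pseudo_manifold_def by blast
  have fin: "finite (\<Union>K)" using sc \<open>finite K\<close> unfolding simplicial_complex_def by blast
  have so: "simplex_orientations K m \<Omega>" using or m unfolding consistent_orientation_def by simp
  have "clique_chain ?adj (\<Union>K) (Suc m) ?c"
  proof (rule clique_chainI[OF alternating_fundamental_chain[OF so]])
    fix xs assume "?c xs \<noteq> 0"
    then have xs: "distinct xs" "set xs \<in> K" "card (set xs) = Suc m"
      unfolding fundamental_chain_def simplices_def by (auto split: if_splits)
    have "?adj a b" if "a \<in> set xs" "b \<in> set xs" for a b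
    proof (cases "a = b")
      case True
      then show ?thesis using unital_subringD(2)[OF sub] by (simp add: scalar_product_left)
    next
      case False
      then have "{a, b} \<in> simplices K 1"
        using face_in_complex[OF sc xs(2), of "{a, b}"] that unfolding simplices_def by simp
      then show ?thesis by (rule edges)
    qed
    then show "length xs = Suc m \<and> set xs \<subseteq> \<Union>K \<and> (\<forall>a\<in>set xs. \<forall>b\<in>set xs. ?adj a b)"
      using xs distinct_card by fastforce
  qed
  moreover have "boundary (\<Union>K) ?c ys = 0" for ys
    using fundamental_chain_cycle[of K m \<Omega> ys] pm or \<open>finite K\<close> m by simp
  moreover have "cycles_bound ?adj (\<Union>K) (Suc m)"
    using cycles_bound_integral_distances[OF val sqrt half fin, where k = m and p = p] m by simp
  ultimately obtain h where h: "clique_chain ?adj (\<Union>K) (Suc (Suc m)) h"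
    and bh: "\<And>ys. boundary (\<Union>K) h ys = ?c ys"
    unfolding cycles_bound_def by blast
  have "of_nat (Suc CARD('n)) * (\<Sum>xs\<in>words (\<Union>K) CARD('n). of_int (?c xs) * cone_det e p base xs) \<in> A"
    using boundary_volume_integral[OF val half e fin, of p h base] h unfolding m(1) bh by blast
  also have "(\<Sum>xs\<in>words (\<Union>K) CARD('n). of_int (?c xs) * cone_det e p base xs)
      = of_nat (fact CARD('n)) * (\<Sum>\<sigma>\<in>simplices K m. cone_det e p base (SOME xs. xs \<in> orderings \<sigma> \<and> xs \<in> \<Omega>))"
    unfolding m(1)
    by (rule fundamental_chain_pairing[OF sc so \<open>finite K\<close> _ alternating_cone_det[OF e]]) (use m in simp)
  finally show ?thesis unfolding m(1) diff_Suc_1 .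
qed

section \<open>An ultrapower of the complex numbers\<close>

definition free_ultrafilter :: "nat set set \<Rightarrow> bool" where
  "free_ultrafilter U \<longleftrightarrow> (\<forall>A\<in>U. infinite A) \<and> (\<forall>A\<in>U. \<forall>B\<in>U. A \<inter> B \<in> U) \<and> (\<forall>A. A \<in> U \<or> - A \<in> U)"

text \<open>A maximal filter containing the cofinite sets is an ultrafilter: if \<open>A\<close> meets all of its members in
  infinite sets, then \<open>A\<close> can be added to it; and otherwise the complement of \<open>A\<close> meets all of its
  members in infinite sets.\<close>
lemma free_ultrafilter_exists: "\<exists>U. free_ultrafilter U"
proof -
  define filt :: "nat set set \<Rightarrow> bool" where "filt F \<longleftrightarrow> (\<forall>A\<in>F. infinite A) \<and>
    (\<forall>A\<in>F. \<forall>B\<in>F. A \<inter> B \<in> F) \<and> (\<forall>A. finite (- A) \<longrightarrow> A \<in> F)" for F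
  have filtD: "infinite A" "B \<in> F \<Longrightarrow> A \<inter> B \<in> F" if "filt F" "A \<in> F" for F A B
    using that unfolding filt_def by blast+
  have filt_cofinite: "A \<in> F" if "filt F" "finite (- A)" for F A
    using that unfolding filt_def by blast
  have "\<exists>M\<in>Collect filt. \<forall>X\<in>Collect filt. M \<subseteq> X \<longrightarrow> X = M"
  proof (rule subset_Zorn_nonempty)
    have "infinite A" if "finite (- A)" for A :: "nat set"
      using that by (metis finite_Un Compl_partition infinite_UNIV_nat)
    then have "filt {A. finite (- A)}"
      unfolding filt_def mem_Collect_eq Ball_def Compl_Int finite_Un by blast
    then show "Collect filt \<noteq> {}" by (metis empty_Collect_eq)
    fix \<C> assume C: "\<C> \<noteq> {}" "subset.chain (Collect filt) \<C>"
    then have C': "\<And>F. F \<in> \<C> \<Longrightarrow> filt F" and lin: "\<And>F G. F \<in> \<C> \<Longrightarrow> G \<in> \<C> \<Longrightarrow> F \<subseteq> G \<or> G \<subseteq> F"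
      unfolding subset_chain_def by auto
    have "A \<inter> B \<in> \<Union>\<C>" if AB: "A \<in> \<Union>\<C>" "B \<in> \<Union>\<C>" for A B
    proof -
      obtain F where F: "F \<in> \<C>" "A \<in> F" "B \<in> F" using AB lin by blast
      then have "A \<inter> B \<in> F" using filtD(2)[OF C'[OF F(1)]] by blast
      then show ?thesis using F by blast
    qed
    moreover have "A \<in> \<Union>\<C>" if "finite (- A)" for A
      using C(1) filt_cofinite[OF C' that] by blast
    moreover have "infinite A" if "A \<in> \<Union>\<C>" for A
      using filtD(1)[OF C'] that by blast
    ultimately have "filt (\<Union>\<C>)" unfolding filt_def by blast
    then show "\<Union>\<C> \<in> Collect filt" by simp
  qed
  then obtain M where "M \<in> Collect filt" and max0: "\<forall>X\<in>Collect filt. M \<subseteq> X \<longrightarrow> X = M"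
    by (rule bexE)
  then have M: "filt M" by simp
  have max: "X = M" if "filt X" "M \<subseteq> X" for X using max0 that by simp
  note inf = filtD(1)[OF M] and int = filtD(2)[OF M] and cof = filt_cofinite[OF M]
  have UM: "UNIV \<in> M" using cof[of UNIV] by simp
  have "A \<in> M" if A: "\<And>B. B \<in> M \<Longrightarrow> infinite (A \<inter> B)" for A
  proof -
    let ?X = "{C. \<exists>B\<in>M. A \<inter> B \<subseteq> C}"
    have "infinite C" if "C \<in> ?X" for C using that A finite_subset by blast
    moreover have "C \<inter> D \<in> ?X" if CD: "C \<in> ?X" "D \<in> ?X" for C D
    proof -
      obtain B B' where "B \<in> M" "B' \<in> M" "A \<inter> B \<subseteq> C" "A \<inter> B' \<subseteq> D" using CD by blast
      then show ?thesis using int[of B B'] by blast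
    qed
    moreover have MX: "M \<subseteq> ?X" by blast
    moreover have "C \<in> ?X" if "finite (- C)" for C using cof[OF that] MX by blast
    ultimately have "filt ?X"
      unfolding filt_def by (intro conjI ballI allI impI)
    then have "?X = M" using MX by (rule max)
    then show ?thesis using UM by blast
  qed
  then have "A \<in> M \<or> - A \<in> M" for A
  proof -
    {
      assume "A \<notin> M" "- A \<notin> M"
      then obtain B B' where B: "B \<in> M" "B' \<in> M" "finite (A \<inter> B)" "finite (- A \<inter> B')"
        using \<open>\<And>A. (\<And>B. B \<in> M \<Longrightarrow> infinite (A \<inter> B)) \<Longrightarrow> A \<in> M\<close> by meson
      then have "finite (B \<inter> B')"
        by (rule_tac finite_subset[of _ "(A \<inter> B) \<union> (- A \<inter> B')"]) auto
      then have False using inf int B by blast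
    }
    then show ?thesis by blast
  qed
  then have "free_ultrafilter M"
    unfolding free_ultrafilter_def using inf int by (intro conjI ballI allI)
  then show ?thesis by (rule exI)
qed

text \<open>Any choice will do; it is fixed once so that the ultrapower becomes a type.\<close>
definition the_ultrafilter :: "nat set set" where
  "the_ultrafilter = (SOME U. free_ultrafilter U)"

lemma the_ultrafilter: "free_ultrafilter the_ultrafilter"
  unfolding the_ultrafilter_def by (rule someI_ex[OF free_ultrafilter_exists])

lemma the_ultrafilter_infinite: "A \<in> the_ultrafilter \<Longrightarrow> infinite A"
  and the_ultrafilter_Int: "A \<in> the_ultrafilter \<Longrightarrow> B \<in> the_ultrafilter \<Longrightarrow> A \<inter> B \<in> the_ultrafilter"
  and the_ultrafilter_Compl: "A \<in> the_ultrafilter \<or> - A \<in> the_ultrafilter"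
  using the_ultrafilter unfolding free_ultrafilter_def by blast+

lemma the_ultrafilter_mono:
  assumes "A \<in> the_ultrafilter" "A \<subseteq> B"
  shows "B \<in> the_ultrafilter"
proof (rule ccontr)
  assume "B \<notin> the_ultrafilter"
  then have "A \<inter> - B \<in> the_ultrafilter"
    using the_ultrafilter_Compl the_ultrafilter_Int assms(1) by blast
  moreover have "A \<inter> - B = {}" using assms(2) by blast
  ultimately show False using the_ultrafilter_infinite by force
qed

lemma the_ultrafilter_UNIV: "UNIV \<in> the_ultrafilter"
  using the_ultrafilter_Compl[of UNIV] the_ultrafilter_infinite[of "{}"] by auto

definition ultra_eq :: "(nat \<Rightarrow> complex) \<Rightarrow> (nat \<Rightarrow> complex) \<Rightarrow> bool" where
  "ultra_eq f g \<longleftrightarrow> {k. f k = g k} \<in> the_ultrafilter"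

lemma ultra_eq_equivp: "equivp ultra_eq"
proof (rule equivpI)
  show "reflp ultra_eq" unfolding reflp_def ultra_eq_def by (simp add: the_ultrafilter_UNIV)
  show "symp ultra_eq" unfolding symp_def ultra_eq_def by (simp add: eq_commute)
  show "transp ultra_eq"
    unfolding transp_def ultra_eq_def
  proof (intro allI impI)
    fix f g h :: "nat \<Rightarrow> complex"
    assume "{k. f k = g k} \<in> the_ultrafilter" "{k. g k = h k} \<in> the_ultrafilter"
    from the_ultrafilter_Int[OF this] show "{k. f k = h k} \<in> the_ultrafilter"
      by (rule the_ultrafilter_mono) auto
  qed
qed

lemma ultra_eq_cong2:
  assumes "ultra_eq f f'" "ultra_eq g g'"
  shows "ultra_eq (\<lambda>k. F (f k) (g k)) (\<lambda>k. F (f' k) (g' k))"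
proof -
  have "{k. f k = f' k} \<inter> {k. g k = g' k} \<in> the_ultrafilter"
    using assms the_ultrafilter_Int unfolding ultra_eq_def by blast
  then show ?thesis unfolding ultra_eq_def by (rule the_ultrafilter_mono) auto
qed

lemma ultra_eq_cong1: "ultra_eq f f' \<Longrightarrow> ultra_eq (\<lambda>k. F (f k)) (\<lambda>k. F (f' k))"
  using ultra_eq_cong2[of f f' f f' "\<lambda>a b. F a"] by simp

quotient_type ultra_complex = "nat \<Rightarrow> complex" / ultra_eq
  by (rule ultra_eq_equivp)

instantiation ultra_complex :: field
begin

lift_definition zero_ultra_complex :: ultra_complex is "\<lambda>k. 0" .
lift_definition one_ultra_complex :: ultra_complex is "\<lambda>k. 1" .
lift_definition plus_ultra_complex :: "ultra_complex \<Rightarrow> ultra_complex \<Rightarrow> ultra_complex"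
  is "\<lambda>f g k. f k + g k" by (rule ultra_eq_cong2)
lift_definition minus_ultra_complex :: "ultra_complex \<Rightarrow> ultra_complex \<Rightarrow> ultra_complex"
  is "\<lambda>f g k. f k - g k" by (rule ultra_eq_cong2)
lift_definition times_ultra_complex :: "ultra_complex \<Rightarrow> ultra_complex \<Rightarrow> ultra_complex"
  is "\<lambda>f g k. f k * g k" by (rule ultra_eq_cong2)
lift_definition divide_ultra_complex :: "ultra_complex \<Rightarrow> ultra_complex \<Rightarrow> ultra_complex"
  is "\<lambda>f g k. f k / g k" by (rule ultra_eq_cong2)
lift_definition uminus_ultra_complex :: "ultra_complex \<Rightarrow> ultra_complex"
  is "\<lambda>f k. - f k" by (rule ultra_eq_cong1)
lift_definition inverse_ultra_complex :: "ultra_complex \<Rightarrow> ultra_complex"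
  is "\<lambda>f k. inverse (f k)" by (rule ultra_eq_cong1)

instance
proof
  have eqI: "ultra_eq f g" if "\<And>k. f k = g k" for f g
    using that by (simp add: ultra_eq_def the_ultrafilter_UNIV)
  fix a b c :: ultra_complex
  show "a * b * c = a * (b * c)" by transfer (rule eqI, simp)
  show "a * b = b * a" by transfer (rule eqI, simp)
  show "1 * a = a" by transfer (rule eqI, simp)
  show "a + b + c = a + (b + c)" by transfer (rule eqI, simp)
  show "a + b = b + a" by transfer (rule eqI, simp)
  show "0 + a = a" by transfer (rule eqI, simp)
  show "- a + a = 0" by transfer (rule eqI, simp)
  show "a - b = a + - b" by transfer (rule eqI, simp)
  show "(a + b) * c = a * c + b * c" by transfer (rule eqI, simp add: distrib_right)
  show "a div b = a * inverse b" by transfer (rule eqI, simp add: divide_inverse)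
  show "inverse 0 = (0 :: ultra_complex)" by transfer (rule eqI, simp)
  show "(0 :: ultra_complex) \<noteq> 1"
    by transfer (use the_ultrafilter_infinite[of "{}"] in \<open>auto simp: ultra_eq_def\<close>)
  show "inverse a * a = 1" if "a \<noteq> 0"
    using that
  proof transfer
    fix f assume "\<not> ultra_eq f (\<lambda>k. 0)"
    then have "- {k. f k = 0} \<in> the_ultrafilter"
      using the_ultrafilter_Compl unfolding ultra_eq_def by blast
    then show "ultra_eq (\<lambda>k. inverse (f k) * f k) (\<lambda>k. 1)"
      unfolding ultra_eq_def by (rule the_ultrafilter_mono) auto
  qed
qed

end

lift_definition ultra :: "(nat \<Rightarrow> complex) \<Rightarrow> ultra_complex" is "\<lambda>f. f" .

lemma ultra_eq_iff: "ultra f = ultra g \<longleftrightarrow> {k. f k = g k} \<in> the_ultrafilter"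
  by transfer (simp add: ultra_eq_def)

lemma ultra_cases: "\<exists>f. x = ultra f"
  by transfer (use ultra_eq_equivp in \<open>auto dest: equivp_reflp\<close>)

lemma ultra_add: "ultra f + ultra g = ultra (\<lambda>k. f k + g k)"
  and ultra_diff: "ultra f - ultra g = ultra (\<lambda>k. f k - g k)"
  and ultra_mult: "ultra f * ultra g = ultra (\<lambda>k. f k * g k)"
  and ultra_inverse: "inverse (ultra f) = ultra (\<lambda>k. inverse (f k))"
  and ultra_0: "0 = ultra (\<lambda>k. 0)"
  and ultra_1: "1 = ultra (\<lambda>k. 1)"
  by (transfer, simp add: equivp_reflp[OF ultra_eq_equivp])+

lemma ultra_sum: "(\<Sum>i\<in>I. ultra (f i)) = ultra (\<lambda>k. \<Sum>i\<in>I. f i k)"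
  by (induction I rule: infinite_finite_induct) (auto simp: ultra_add ultra_0)

lemma ultra_prod: "(\<Prod>i\<in>I. ultra (f i)) = ultra (\<lambda>k. \<Prod>i\<in>I. f i k)"
  by (induction I rule: infinite_finite_induct) (auto simp: ultra_mult ultra_1)

lemma ultra_of_nat: "of_nat m = ultra (\<lambda>k. of_nat m)"
  by (induction m) (auto simp: ultra_add ultra_0 ultra_1)

lemma ultra_of_int: "of_int z = ultra (\<lambda>k. of_int z)"
  by (cases z rule: int_diff_cases) (simp add: ultra_of_nat ultra_diff)

lemma ultra_sqrt: "\<exists>s. s * s = (x :: ultra_complex)"
proof -
  obtain f where "x = ultra f" using ultra_cases by blast
  moreover have "csqrt z * csqrt z = z" for z
    using power2_csqrt[of z] by (simp add: power2_eq_square)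
  ultimately have "ultra (\<lambda>k. csqrt (f k)) * ultra (\<lambda>k. csqrt (f k)) = x"
    by (simp add: ultra_mult)
  then show ?thesis by blast
qed

lemma det_ultra:
  fixes M :: "nat \<Rightarrow> real ^ 'n ^ 'n"
  shows "det (\<chi> i j. ultra (\<lambda>k. complex_of_real (M k $ i $ j))) = ultra (\<lambda>k. complex_of_real (det (M k)))"
  unfolding det_def by (simp add: ultra_of_int ultra_prod ultra_mult ultra_sum)

text \<open>The class of a sequence that takes no value twice is transcendental over the constants, since a
  polynomial has finitely many roots and the sets in the ultrafilter are infinite. So it does
  not lie in the ring generated by its inverse and the constants.\<close>
lemma valuation_ring_excluding_injective_sequence:
  fixes V :: "nat \<Rightarrow> complex"
  assumes "inj V" and nz: "\<And>k. V k \<noteq> 0"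
  shows "\<exists>A. valuation_ring A \<and> (\<forall>c. ultra (\<lambda>k. c) \<in> A) \<and> ultra V \<notin> A"
proof -
  define z where "z k = inverse (V k)" for k
  have injz: "inj z" using assms unfolding z_def inj_def by (metis inverse_inverse_eq)
  let ?A0 = "{ultra (\<lambda>k. poly p (z k)) | p. True}"
  have I: "ultra (\<lambda>k. poly p (z k)) \<in> ?A0" for p by blast
  have "unital_subring ?A0"
    unfolding unital_subring_def
  proof (intro conjI ballI)
    show "1 \<in> ?A0" using I[of 1] by (simp add: ultra_1)
    fix x y assume "x \<in> ?A0" "y \<in> ?A0"
    then obtain p q where "x = ultra (\<lambda>k. poly p (z k))" "y = ultra (\<lambda>k. poly q (z k))" by blast
    then show "x - y \<in> ?A0" "x * y \<in> ?A0"
      using I[of "p - q"] I[of "p * q"] by (simp_all add: ultra_diff ultra_mult)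
  qed
  moreover have "inverse (ultra V) \<in> ?A0"
    using I[of "[:0, 1:]"] by (simp add: ultra_inverse z_def)
  moreover have "ultra V \<notin> ?A0"
  proof
    assume "ultra V \<in> ?A0"
    then obtain p where p: "{k. V k = poly p (z k)} \<in> the_ultrafilter"
      by (auto simp: ultra_eq_iff)
    \<comment> \<open>If \<open>V k = p(1/V k)\<close>, then \<open>1/V k\<close> is a root of \<open>X p(X) - 1\<close>, a polynomial with nonzero constant term.\<close>
    let ?q = "pCons (- 1) p"
    have "z ` {k. V k = poly p (z k)} \<subseteq> {x. poly ?q x = 0}"
    proof clarify
      fix k assume k: "V k = poly p (z k)"
      show "poly ?q (z k) = 0" using nz[of k] unfolding poly_pCons k[symmetric] by (simp add: z_def)
    qed
    moreover have "infinite (z ` {k. V k = poly p (z k)})"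
      using the_ultrafilter_infinite[OF p] injz by (metis finite_imageD inj_on_subset subset_UNIV)
    ultimately have "infinite {x. poly ?q x = 0}" using finite_subset by blast
    then have "?q = 0" using poly_roots_finite by blast
    then show False by simp
  qed
  ultimately obtain A where "valuation_ring A" "?A0 \<subseteq> A" "ultra V \<notin> A"
    using valuation_ring_avoiding by blast
  moreover have "ultra (\<lambda>k. c) \<in> ?A0" for c using I[of "[:c:]"] by simp
  ultimately show ?thesis by blast
qed

section \<open>Flexes\<close>

lemma generalized_volume_eq:
  fixes P :: "('v \<Rightarrow> real) \<Rightarrow> real ^ 'n"
  assumes e: "bij_betw e UNIV {..<CARD('n)}" and sc: "simplicial_complex K"
    and or: "simplex_orientations K (CARD('n) - 1) \<Omega>" and n: "CARD('n) \<ge> 2"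
  shows "fact CARD('n) * generalized_volume e K \<Omega> O0 P = (\<Sum>\<sigma>\<in>simplices K (CARD('n) - 1).
    cone_det e (\<lambda>v. P (vertex_point v)) O0 (SOME xs. xs \<in> orderings \<sigma> \<and> xs \<in> \<Omega>))"
proof -
  have "fact CARD('n) * oriented_volume e O0 (map (\<lambda>v. P (vertex_point v)) xs)
      = cone_det e (\<lambda>v. P (vertex_point v)) O0 xs"
    if "\<sigma> \<in> simplices K (CARD('n) - 1)" and xs: "xs = (SOME xs. xs \<in> orderings \<sigma> \<and> xs \<in> \<Omega>)" for \<sigma> xs
  proof -
    have "CARD('n) - 1 > 0" using n by simp
    from someI_ex[OF positive_ordering_exists[OF or sc that(1) this]]
    have "xs \<in> orderings \<sigma>" unfolding xs by blast
    then have len: "length xs = CARD('n)"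
      using that(1) n distinct_card[of xs] unfolding orderings_def simplices_def by auto
    have elt: "e j < CARD('n)" for j using e by (auto simp: bij_betw_def)
    show ?thesis unfolding oriented_volume_def cone_det_def by (simp add: len elt)
  qed
  then show ?thesis unfolding generalized_volume_def sum_distrib_left by (intro sum.cong refl) blast
qed

lemma continuous_on_vertex:
  assumes flex: "is_flex K P Pt" and "simplicial_complex K" "v \<in> \<Union>K"
  shows "continuous_on {0..1} (\<lambda>t. Pt t (vertex_point v))"
proof -
  obtain \<sigma> where "\<sigma> \<in> K" "v \<in> \<sigma>" using assms by blast
  then have "{v} \<in> K" using face_in_complex[OF assms(2), of \<sigma> "{v}"] by simp
  moreover have "vertex_point v \<in> closed_simplex {v}"
    unfolding vertex_point_def closed_simplex_def by (auto simp: indicator_def)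
  ultimately have "vertex_point v \<in> realization K" unfolding realization_def by blast
  then have "(\<lambda>t. (t, vertex_point v)) ` {0..1} \<subseteq> {0..1} \<times> realization K" by auto
  moreover have "continuous_on ({0..1} \<times> realization K) (\<lambda>(t, x). Pt t x)"
    using flex unfolding is_flex_def by blast
  moreover have "continuous_on {0..1::real} (\<lambda>t. (t, vertex_point v))"
    by (intro continuous_intros)
  ultimately have "continuous_on {0..1} ((\<lambda>(t, x). Pt t x) \<circ> (\<lambda>t. (t, vertex_point v)))"
    using continuous_on_compose continuous_on_subset by metis
  then show ?thesis by (simp add: o_def)
qed

text \<open>If the volume took infinitely many values, choose parameters \<open>t k\<close> with distinct nonzero
  volumes. The polyhedra \<open>Pt (t k)\<close> together form one polyhedron over the ultrapower. Its squared edge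
  lengths are constants and hence belong to every valuation ring \<open>A\<close> containing the constants, whereas
  \<open>A\<close> can be chosen so as not to contain its volume.\<close>
lemma flex_volume_finite_range:
  fixes K :: "'v set set" and Pt :: "real \<Rightarrow> ('v \<Rightarrow> real) \<Rightarrow> real ^ 'n"
  assumes n: "CARD('n) \<ge> 3" and e: "bij_betw e UNIV {..<CARD('n)}" and finK: "finite K"
    and pm: "pseudo_manifold K (CARD('n) - 1)" and or: "consistent_orientation K (CARD('n) - 1) \<Omega>"
    and edges: "\<And>u v. {u, v} \<in> simplices K 1 \<Longrightarrow>
      (\<lambda>t. dist (Pt t (vertex_point u)) (Pt t (vertex_point v))) constant_on I"
  shows "finite ((\<lambda>t. generalized_volume e K \<Omega> O0 (Pt t)) ` I)"
proof (rule ccontr)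
  let ?V = "\<lambda>t. generalized_volume e K \<Omega> O0 (Pt t)"
  let ?\<sigma>s = "simplices K (CARD('n) - 1)"
  let ?pos = "\<lambda>\<sigma>. SOME xs. xs \<in> orderings \<sigma> \<and> xs \<in> \<Omega>"
  assume "infinite (?V ` I)"
  \<comment> \<open>The value 0 is left out because the inverse of the volume is needed.\<close>
  then have "infinite (?V ` I - {0})" by simp
  then obtain g :: "nat \<Rightarrow> real" where g: "inj g" "range g \<subseteq> ?V ` I - {0}"
    using infinite_countable_subset by blast
  have gk: "g k \<in> ?V ` I - {0}" for k by (rule subsetD[OF g(2) rangeI])
  have "\<exists>t. t \<in> I \<and> ?V t = g k" for k using gk[of k] by auto
  then obtain t where t: "\<And>k. t k \<in> I" "\<And>k. ?V (t k) = g k" by metis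
  have "inj (\<lambda>k. complex_of_real (g k))" using g(1) by (simp add: inj_def)
  moreover have "complex_of_real (g k) \<noteq> 0" for k using gk[of k] by auto
  ultimately obtain A where val: "valuation_ring A" and const: "\<And>c. ultra (\<lambda>k. c) \<in> A"
    and notin: "ultra (\<lambda>k. complex_of_real (g k)) \<notin> A"
    using valuation_ring_excluding_injective_sequence by blast
  have ultra_2: "(2 :: ultra_complex) = ultra (\<lambda>k. 2)"
    using ultra_of_nat[of 2] by simp
  have half: "inverse 2 \<in> A" unfolding ultra_2 ultra_inverse by (rule const)
  have two: "(2 :: ultra_complex) \<noteq> 0"
    unfolding ultra_2 ultra_0 ultra_eq_iff using the_ultrafilter_infinite[of "{}"] by auto
  define p :: "'v \<Rightarrow> ultra_complex ^ 'n" where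
    "p v = (\<chi> i. ultra (\<lambda>k. complex_of_real (Pt (t k) (vertex_point v) $ i)))" for v
  define base :: "ultra_complex ^ 'n" where "base = (\<chi> i. ultra (\<lambda>k. complex_of_real (O0 $ i)))"
  have "scalar_product (p u - p v) (p u - p v) \<in> A" if "{u, v} \<in> simplices K 1" for u v
  proof -
    obtain d where "dist (Pt s (vertex_point u)) (Pt s (vertex_point v)) = d" if "s \<in> I" for s
      using edges[OF \<open>{u, v} \<in> simplices K 1\<close>] unfolding constant_on_def by blast
    then have d: "dist (Pt (t k) (vertex_point u)) (Pt (t k) (vertex_point v)) = d" for k using t by blast
    let ?q = "\<lambda>k. Pt (t k) (vertex_point u) - Pt (t k) (vertex_point v)"
    have "(\<Sum>i\<in>UNIV. ?q k $ i * ?q k $ i) = d\<^sup>2" for k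
      using d[of k] unfolding dist_norm by (metis inner_real_def inner_vec_def power2_norm_eq_inner)
    then have *: "(\<Sum>i\<in>UNIV. complex_of_real (?q k $ i * ?q k $ i)) = complex_of_real (d\<^sup>2)" for k
      by (metis of_real_sum)
    have "scalar_product (p u - p v) (p u - p v)
        = ultra (\<lambda>k. \<Sum>i\<in>UNIV. complex_of_real (?q k $ i * ?q k $ i))"
      unfolding scalar_product_def p_def by (simp add: ultra_diff ultra_mult ultra_sum)
    then show ?thesis unfolding * using const by simp
  qed
  with pseudo_manifold_volume_integral[OF val half two ultra_sqrt n e finK pm or, where p = p and base = base]
  have int: "of_nat (Suc CARD('n)) * (of_nat (fact CARD('n)) * (\<Sum>\<sigma>\<in>?\<sigma>s. cone_det e p base (?pos \<sigma>))) \<in> A"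
    by blast
  have "cone_det e p base xs
      = ultra (\<lambda>k. complex_of_real (cone_det e (\<lambda>v. Pt (t k) (vertex_point v)) O0 xs))" for xs
  proof -
    let ?M = "\<lambda>k. (\<chi> i j. (Pt (t k) (vertex_point (xs ! e j)) - O0) $ i) :: real ^ 'n ^ 'n"
    have "(\<chi> i j. (p (xs ! e j) - base) $ i) = (\<chi> i j. ultra (\<lambda>k. complex_of_real (?M k $ i $ j)))"
      unfolding p_def base_def by (simp add: ultra_diff vec_eq_iff)
    then show ?thesis unfolding cone_det_def by (simp only: det_ultra) (simp add: ultra_0)
  qed
  then have "(\<Sum>\<sigma>\<in>?\<sigma>s. cone_det e p base (?pos \<sigma>))
      = ultra (\<lambda>k. complex_of_real (\<Sum>\<sigma>\<in>?\<sigma>s. cone_det e (\<lambda>v. Pt (t k) (vertex_point v)) O0 (?pos \<sigma>)))"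
    by (simp add: ultra_sum)
  also have "\<dots> = ultra (\<lambda>k. complex_of_real (fact CARD('n) * g k))"
    using generalized_volume_eq[OF e, of K \<Omega> O0 "Pt (t k)" for k] pm or n t(2)
    unfolding pseudo_manifold_def consistent_orientation_def by simp
  finally have sum: "(\<Sum>\<sigma>\<in>?\<sigma>s. cone_det e p base (?pos \<sigma>)) = ultra (\<lambda>k. complex_of_real (fact CARD('n) * g k))" .
  define C where "C = complex_of_real (of_nat (Suc CARD('n)) * (of_nat (fact CARD('n)) * fact CARD('n)))"
  have C: "C \<noteq> 0" unfolding C_def by (simp del: of_nat_Suc)
  have "ultra (\<lambda>k. C * complex_of_real (g k)) \<in> A"
    using int unfolding sum ultra_of_nat ultra_mult C_def by (simp add: mult.assoc)
  then have "ultra (\<lambda>k. inverse C) * ultra (\<lambda>k. C * complex_of_real (g k)) \<in> A"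
    using val const unital_subringD(4) unfolding valuation_ring_def by blast
  then show False using notin C by (simp add: ultra_mult flip: mult.assoc)
qed

theorem corollary1p5:
  fixes K :: "'v set set"
    and \<Omega> :: "'v list set"
    and P :: "('v \<Rightarrow> real) \<Rightarrow> real ^ 'n"
    and Pt :: "real \<Rightarrow> ('v \<Rightarrow> real) \<Rightarrow> real ^ 'n"
    and e :: "'n \<Rightarrow> nat"
    and O0 :: "real ^ 'n"
  assumes "CARD('n) \<ge> 3"
    and "bij_betw e UNIV {..<CARD('n)}"
    and "finite K"
    and "pseudo_manifold K (CARD('n) - 1)"
    and "strongly_connected K (CARD('n) - 1)"
    and "consistent_orientation K (CARD('n) - 1) \<Omega>"
    and "polyhedron_of_type K P"
    and "flexible K P"
    and "is_flex K P Pt"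
  shows "(\<lambda>t. generalized_volume e K \<Omega> O0 (Pt t)) constant_on {0..1}"
proof (rule continuous_finite_range_constant)
  let ?\<sigma>s = "simplices K (CARD('n) - 1)"
  let ?pos = "\<lambda>\<sigma>. SOME xs. xs \<in> orderings \<sigma> \<and> xs \<in> \<Omega>"
  have sc: "simplicial_complex K" using assms(4) unfolding pseudo_manifold_def by blast
  have or: "simplex_orientations K (CARD('n) - 1) \<Omega>"
    using assms(6) unfolding consistent_orientation_def by blast
  have "continuous_on {0..1} (\<lambda>t. cone_det e (\<lambda>v. Pt t (vertex_point v)) O0 (?pos \<sigma>))"
    if \<sigma>: "\<sigma> \<in> ?\<sigma>s" for \<sigma>
  proof (cases "length (?pos \<sigma>) = CARD('n)")
    case True
    have "?pos \<sigma> \<in> orderings \<sigma>"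
      using someI_ex[OF positive_ordering_exists[OF or sc \<sigma>]] assms(1) by simp
    moreover have "e j < length (?pos \<sigma>)" for j
      using True assms(2) by (auto simp: bij_betw_def)
    ultimately have "?pos \<sigma> ! e j \<in> \<Union>K" for j
      using \<sigma> nth_mem unfolding orderings_def simplices_def by blast
    note cont = continuous_on_vertex[OF assms(9) sc this]
    show ?thesis
      unfolding cone_det_def det_def using True by (simp, intro continuous_intros cont)
  qed (simp add: cone_det_def)
  then have "continuous_on {0..1} (\<lambda>t. (\<Sum>\<sigma>\<in>?\<sigma>s.
      cone_det e (\<lambda>v. Pt t (vertex_point v)) O0 (?pos \<sigma>)) / fact CARD('n))"
    by (intro continuous_intros) auto
  moreover have "(\<Sum>\<sigma>\<in>?\<sigma>s. cone_det e (\<lambda>v. Pt t (vertex_point v)) O0 (?pos \<sigma>)) / fact CARD('n)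
      = generalized_volume e K \<Omega> O0 (Pt t)" for t
    using generalized_volume_eq[OF assms(2) sc or, of O0 "Pt t"] assms(1) by (simp add: field_simps)
  ultimately show "continuous_on {0..1} (\<lambda>t. generalized_volume e K \<Omega> O0 (Pt t))" by simp
  show "finite ((\<lambda>t. generalized_volume e K \<Omega> O0 (Pt t)) ` {0..1})"
    using assms(9) unfolding is_flex_def
    by (intro flex_volume_finite_range assms(1-4,6)) blast
qed simp

end
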